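(* Let $S(t,z)=S_t(z)$ be a time-dependent family of Schwarz functions, defined for $z$ near the real axis, satisfying the one-parameter group equation $S_{t+u}=S_t\circ S_u$, $S_0=\mathrm{Id}$, and hence the partial differential equation $\dot S(t,z)=-2iv(z)S'(t,z)$, $S(0,z)=z$, where $v(z)=\frac{i}{2}\dot S(0,z)$. Let $\Gamma_t=\{z:\bar z=S(t,z)\}$ be the corresponding curves. Then the equations of continuous reflection are reducible to quadrature; specifically: (a) For each $z$, the function $t\mapsto S(t,z)$ solves the separable ordinary differential equation (with parameter $z$) $\frac{dS}{dt}=-2iv(S)$, $S(0,z)=z$. (b) The canonical parametrization $\gamma(t,x)=S(-t/2,x)$, $x\in\mathbb{R}$, of $\Gamma_t$ satisfies the ordinary differential equation $\frac{d\gamma}{dt}=iv(\gamma)$, $\gamma(0,x)=x$. (c) In particular, $W(z)=iv(z)\partial_z$ is the normal velocity vector field of the moving curve $\Gamma_t=\{\gamma(t,x):x\in\mathbb{R}\}$. (d) Consequently, the singular foliation $\{\Gamma_t\}$ coincides with the family of equipotentials $\mathrm{Re}[dz/iv(z)]=0$ defined by the dual meromorphic differential $\omega=dz/iv(z)$. Locally, writing $W=\partial_\phi$ and $\omega=d\phi$, one has $\mathrm{Re}[\phi]=\mathrm{const}=C(t)$ along the equipotential curve $\Gamma_t$.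
   Context: An analytic curve is a set $\Gamma=\gamma(\mathbb{R})\subset\mathbb{C}$ with $\gamma$ holomorphic, $\gamma'\neq 0$ and invertible on a neighborhood of the real axis. For holomorphic $f$, $\bar f(z)=\overline{f(\bar z)}$. The Schwarz function of $\Gamma$ is $S=\bar\gamma\circ\gamma^{-1}$, the unique holomorphic function near $\Gamma$ with $S(z)=\bar z$ on $\Gamma$; then $\Gamma=\{z:\bar z=S(z)\}$. Dots denote $\partial/\partial t$ and primes denote $\partial/\partial z$. All identities are local: they are asserted for $t$, $u$ and $z$ for which the compositions are defined. A $(1,0)$-vector $X=(a+ib)\partial_z$ is identified with the real vector $a\partial_x+b\partial_y$. The equation $\mathrm{Re}[\omega]=0$ describes curves whose tangent vectors $X$ satisfy $\mathrm{Re}[\omega(X)]=0$ (away from zeros of $v$). The dual of $\omega$ is the vector field $W$ with $\omega(W)=1$; if $\omega=d\phi=\phi'\,dz$ locally, then $W=\partial_\phi=(1/\phi')\partial_z$. *)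

theory Defs
  imports "HOL-Complex_Analysis.Complex_Analysis"
begin

text \<open>
  \<open>analytic_param \<gamma> N\<close>: \<open>\<gamma>\<close> is holomorphic and invertible on the neighbourhood \<open>N\<close> of the real axis,
  so that \<open>\<gamma> ` \<real>\<close> is an analytic curve.  As a set of complex numbers, \<open>\<real>\<close> is the real axis.
\<close>

definition analytic_param :: "(complex \<Rightarrow> complex) \<Rightarrow> complex set \<Rightarrow> bool" where
  "analytic_param \<gamma> N \<longleftrightarrow>
     open N \<and> \<real> \<subseteq> N \<and> \<gamma> holomorphic_on N \<and> inj_on \<gamma> N \<and> (\<forall>w\<in>N. deriv \<gamma> w \<noteq> 0)"

definition conj_fun :: "(complex \<Rightarrow> complex) \<Rightarrow> complex \<Rightarrow> complex" where
  "conj_fun f z = cnj (f (cnj z))"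

text \<open>
  \<open>F\<close>, holomorphic on \<open>V\<close>, is the Schwarz function of the analytic curve \<open>\<Gamma> \<subseteq> V\<close>:
  it equals \<open>conj_fun \<gamma> \<circ> \<gamma>\<inverse>\<close> near \<open>\<Gamma>\<close>.  Asking \<open>N\<close> to be symmetric
  makes \<open>conj_fun \<gamma>\<close> meaningful on all of \<open>N\<close>; it is no restriction, since \<open>N\<close> may be shrunk.
\<close>

definition is_schwarz_function ::
    "(complex \<Rightarrow> complex) \<Rightarrow> complex set \<Rightarrow> complex set \<Rightarrow> bool" where
  "is_schwarz_function F V \<Gamma> \<longleftrightarrow>
     open V \<and> F holomorphic_on V \<and>
     (\<exists>\<gamma> N. analytic_param \<gamma> N \<and> cnj ` N = N \<and> \<gamma> ` \<real> = \<Gamma> \<and> \<gamma> ` N \<subseteq> V \<and>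
            (\<forall>z\<in>\<gamma> ` N. F z = conj_fun \<gamma> (inv_into N \<gamma> z)))"

definition schwarz_curve :: "(complex \<Rightarrow> complex) \<Rightarrow> complex set \<Rightarrow> complex set" where
  "schwarz_curve F V = {z \<in> V. cnj z = F z}"

text \<open>
  A local one-parameter group of Schwarz functions.  \<open>T\<close> is the set of times, a symmetric open
  interval around \<open>0\<close>, and \<open>D t\<close> is the domain of \<open>S t\<close>, a neighbourhood of the real axis.  As
  usual for local flows, the times at which a point can be moved form an interval around \<open>0\<close>, and
  the values of \<open>S\<close> lie in \<open>D 0\<close>.  The latter is the domain of the generator \<open>v\<close>,
  so that \<open>v (S t z)\<close> makes sense.  The group law is only required where both sides are
  defined; \<open>D\<close> need not be a maximal flow domain.
\<close>

locale schwarz_group =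
  fixes T :: "real set" and D :: "real \<Rightarrow> complex set" and S :: "real \<Rightarrow> complex \<Rightarrow> complex"
  assumes times: "open T" "is_interval T" "0 \<in> T" "\<And>t. t \<in> T \<Longrightarrow> - t \<in> T"
    and open_domain: "open {(t, z). t \<in> T \<and> z \<in> D t}"
    and real_axis: "\<And>t. t \<in> T \<Longrightarrow> \<real> \<subseteq> D t"
    and domain_0: "connected (D 0)" "cnj ` D 0 = D 0"
    and time_interval: "\<And>t z r. t \<in> T \<Longrightarrow> z \<in> D t \<Longrightarrow> 0 \<le> r \<Longrightarrow> r \<le> 1 \<Longrightarrow> z \<in> D (r * t)"
    and into_domain: "\<And>t z. t \<in> T \<Longrightarrow> z \<in> D t \<Longrightarrow> S t z \<in> D 0"
    and continuous: "continuous_on {(t, z). t \<in> T \<and> z \<in> D t} (\<lambda>(t, z). S t z)"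
    and time_differentiable: "\<And>t z. t \<in> T \<Longrightarrow> z \<in> D t \<Longrightarrow> (\<lambda>s. S s z) differentiable (at t)"
    and time_derivative_continuous:
      "continuous_on {(t, z). t \<in> T \<and> z \<in> D t} (\<lambda>(t, z). vector_derivative (\<lambda>s. S s z) (at t))"
    and schwarz: "\<And>t. t \<in> T \<Longrightarrow> is_schwarz_function (S t) (D t) (schwarz_curve (S t) (D t))"
    and group_0: "\<And>z. z \<in> D 0 \<Longrightarrow> S 0 z = z"
    and group_add: "\<And>t u z. t \<in> T \<Longrightarrow> u \<in> T \<Longrightarrow> t + u \<in> T \<Longrightarrow>
      z \<in> D u \<Longrightarrow> S u z \<in> D t \<Longrightarrow> z \<in> D (t + u) \<Longrightarrow> S (t + u) z = S t (S u z)"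

definition generator :: "(real \<Rightarrow> complex \<Rightarrow> complex) \<Rightarrow> complex \<Rightarrow> complex" where
  "generator S z = (\<i> / 2) * vector_derivative (\<lambda>t. S t z) (at 0)"

definition canonical_param :: "(real \<Rightarrow> complex \<Rightarrow> complex) \<Rightarrow> real \<Rightarrow> real \<Rightarrow> complex" where
  "canonical_param S t x = S (- t / 2) (of_real x)"

text \<open>
  A vector field \<open>W(z) \<partial>\<^sub>z\<close> is represented by its coefficient \<open>W\<close>, whose value at \<open>z\<close> is also the
  corresponding real tangent vector; a differential \<open>\<omega>(z) dz\<close> is represented by its coefficient
  \<open>\<omega>\<close>, and its value on a vector \<open>X\<close> at \<open>z\<close> is \<open>\<omega> z * X\<close>.
\<close>

definition reflection_field :: "(real \<Rightarrow> complex \<Rightarrow> complex) \<Rightarrow> complex \<Rightarrow> complex" where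
  "reflection_field S z = \<i> * generator S z"

definition dual_differential :: "(real \<Rightarrow> complex \<Rightarrow> complex) \<Rightarrow> complex \<Rightarrow> complex" where
  "dual_differential S z = 1 / (\<i> * generator S z)"

text \<open>The component of the velocity of a moving parametrized curve orthogonal to its tangent.\<close>

definition normal_velocity :: "(real \<Rightarrow> real \<Rightarrow> complex) \<Rightarrow> real \<Rightarrow> real \<Rightarrow> complex" where
  "normal_velocity \<gamma> t x =
     (let X = vector_derivative (\<gamma> t) (at x); Y = vector_derivative (\<lambda>s. \<gamma> s x) (at t)
      in Y - ((Y \<bullet> X) / (X \<bullet> X)) *\<^sub>R X)"

definition tangent_vectors :: "complex set \<Rightarrow> complex \<Rightarrow> complex set" where
  "tangent_vectors \<Gamma> z =
     {X. \<exists>c e. 0 < e \<and> c ` {-e<..<e} \<subseteq> \<Gamma> \<and> c 0 = z \<and>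
               (c has_vector_derivative X) (at (0::real))}"

definition equipotential_curve ::
    "(complex \<Rightarrow> complex) \<Rightarrow> (real \<Rightarrow> complex) \<Rightarrow> real set \<Rightarrow> bool" where
  "equipotential_curve \<omega> c J \<longleftrightarrow>
     open J \<and> is_interval J \<and>
     (\<forall>s\<in>J. \<exists>X. X \<noteq> 0 \<and> (c has_vector_derivative X) (at s) \<and> Re (\<omega> (c s) * X) = 0)"

definition is_potential :: "(complex \<Rightarrow> complex) \<Rightarrow> complex set \<Rightarrow> (complex \<Rightarrow> complex) \<Rightarrow> bool" where
  "is_potential \<omega> V \<phi> \<longleftrightarrow> (\<forall>z\<in>V. (\<phi> has_field_derivative \<omega> z) (at z))"

end

theory Submission
  imports Defs
begin

text \<open>
  The group law, differentiated at \<open>0\<close> in either factor, gives the autonomous equation of motion and the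
  linear partial differential equation for the holomorphic field \<open>v\<close>; comparing them, the flow preserves
  \<open>v \<partial>\<^sub>z\<close>.  The essential point is that \<open>v\<close> is real on the real axis, i.e. commutes
  with conjugation.  Near \<open>\<Gamma>\<^sub>t\<close> the map \<open>z \<mapsto> cnj (S t z)\<close> is an involution, for every
  \<open>t\<close>, and differentiating this in \<open>t\<close> yields the symmetry of \<open>v\<close>, provided that the curves
  \<open>\<Gamma>\<^sub>s\<close> accumulate at a point of \<open>\<Gamma>\<^sub>t\<close> as \<open>s\<close> approaches \<open>t\<close>; since there are uncountably many
  times, this happens for some \<open>t\<close>.
  Given the symmetry, \<open>cnj \<circ> S t = S (- t) \<circ> cnj\<close> along trajectories by uniqueness of solutions, and
  trajectories of points of \<open>\<Gamma>\<^sub>t\<close> have their midpoints on the real axis.  In the coordinate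
  \<open>\<phi>\<close> the flow is a translation and the reflected flow \<open>cnj \<circ> S t\<close> is a reflection in a vertical line.
\<close>

subsection \<open>Limit points, ordinary differential equations, potentials\<close>

text \<open>If every point of \<open>A\<close> were isolated in it, each would be cut out of
  \<open>A\<close> by a member of a countable basis. Different points need different members, so
  \<open>A\<close> would be countable.\<close>

lemma uncountable_has_internal_limit_point:
  fixes A :: "'a::second_countable_topology set"
  assumes "uncountable A"
  obtains a where "a \<in> A" "a islimpt A"
proof (rule ccontr)
  assume "\<not> thesis"
  with that have isolated: "\<forall>a\<in>A. \<not> a islimpt A" by blast
  obtain B :: "'a set set" where B: "countable B" "topological_basis B"
    using ex_countable_basis by blast
  have "\<forall>a\<in>A. \<exists>U\<in>B. U \<inter> A = {a}"
  proof
    fix a assume a: "a \<in> A"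
    then obtain O' where "a \<in> O'" "open O'" "\<forall>y\<in>A. y \<in> O' \<longrightarrow> y = a"
      using isolated unfolding islimpt_def by metis
    moreover obtain U where "U \<in> B" "a \<in> U" "U \<subseteq> O'"
      using topological_basisE[OF B(2) \<open>open O'\<close> \<open>a \<in> O'\<close>] by blast
    ultimately show "\<exists>U\<in>B. U \<inter> A = {a}" using a by blast
  qed
  then obtain g where g: "\<forall>a\<in>A. g a \<in> B \<and> g a \<inter> A = {a}" by metis
  then have "inj_on g A" "g ` A \<subseteq> B" by (auto simp: inj_on_def) (metis singletonI singletonD)
  then have "countable A"
    using B(1) by (meson countable_subset countable_image_inj_on)
  with assms show False by simp
qed

lemma has_vector_derivative_shift:
  fixes f :: "real \<Rightarrow> 'a::real_normed_vector"
  assumes "((\<lambda>h. f (t + h)) has_vector_derivative d) (at 0)"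
  shows "(f has_vector_derivative d) (at t)"
proof -
  have "((\<lambda>s. s - t) has_vector_derivative 1) (at t)"
    by (auto intro!: derivative_eq_intros)
  then have "((\<lambda>h. f (t + h)) \<circ> (\<lambda>s. s - t) has_vector_derivative 1 *\<^sub>R d) (at t)"
    by (rule vector_diff_chain_at) (use assms in simp)
  then show ?thesis by (simp add: o_def)
qed

lemma has_vector_derivative_cong_ev:
  assumes "(f has_vector_derivative d) (at x)" "\<forall>\<^sub>F y in nhds x. f y = g y"
  shows "(g has_vector_derivative d) (at x)"
  using assms has_derivative_transform_eventually[of f _ x UNIV g] eventually_nhds_x_imp_x
  by (force simp: has_vector_derivative_def eventually_nhds_conv_at)

text \<open>With \<open>B = 0\<close> this mean value inequality becomes the test used below for
  quantities that are constant along an interval.\<close>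

lemma vector_derivative_bound:
  fixes f :: "real \<Rightarrow> 'a::real_normed_vector"
  assumes "convex I" "\<And>r. r \<in> I \<Longrightarrow> (f has_vector_derivative f' r) (at r within I)"
    and "\<And>r. r \<in> I \<Longrightarrow> norm (f' r) \<le> B" "a \<in> I" "b \<in> I"
  shows "norm (f b - f a) \<le> B * \<bar>b - a\<bar>"
proof -
  have "onorm (\<lambda>h::real. h *\<^sub>R f' r) = norm (f' r)" for r
    using onorm_scaleR_left[OF bounded_linear_ident, of "f' r"] onorm_id[where 'a=real] by simp
  then show ?thesis
    using differentiable_bound[of I f "\<lambda>r h. h *\<^sub>R f' r" B b a] assms
    by (simp add: has_vector_derivative_def)
qed

text \<open>The set where the two solutions agree is closed in \<open>I\<close> by continuity and
  open in \<open>I\<close> by a local Lipschitz estimate, so connectedness of \<open>I\<close> makes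
  it all of \<open>I\<close>.\<close>

lemma autonomous_ode_unique:
  fixes f :: "complex \<Rightarrow> complex" and y1 y2 :: "real \<Rightarrow> complex"
  assumes U: "open U" "f holomorphic_on U"
    and I: "is_interval I"
    and y1: "\<And>r. r \<in> I \<Longrightarrow> y1 r \<in> U \<and> (y1 has_vector_derivative f (y1 r)) (at r within I)"
    and y2: "\<And>r. r \<in> I \<Longrightarrow> y2 r \<in> U \<and> (y2 has_vector_derivative f (y2 r)) (at r within I)"
    and a: "a \<in> I" "y1 a = y2 a" and "b \<in> I"
  shows "y1 b = y2 b"
proof -
  have cont: "continuous_on I y1" "continuous_on I y2"
    using y1 y2 has_vector_derivative_continuous continuous_on_eq_continuous_within by blast+
  have open_eq: "\<exists>d>0. \<forall>r\<in>I. dist r r0 < d \<longrightarrow> y1 r = y2 r" if r0: "r0 \<in> I" "y1 r0 = y2 r0" for r0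
  proof -
    obtain \<delta> where \<delta>: "\<delta> > 0" "cball (y1 r0) \<delta> \<subseteq> U"
      using U(1) y1[OF r0(1)] open_contains_cball by blast
    have "continuous_on (cball (y1 r0) \<delta>) (deriv f)"
      using U \<delta>(2) holomorphic_deriv holomorphic_on_imp_continuous_on continuous_on_subset by metis
    then have "bounded (deriv f ` cball (y1 r0) \<delta>)"
      by (intro compact_imp_bounded compact_continuous_image) auto
    then obtain L where L: "L > 0" "\<And>z. z \<in> cball (y1 r0) \<delta> \<Longrightarrow> norm (deriv f z) \<le> L"
      unfolding bounded_pos by auto
    have lip: "norm (f z - f w) \<le> L * norm (z - w)"
      if "z \<in> cball (y1 r0) \<delta>" "w \<in> cball (y1 r0) \<delta>" for z w
    proof (rule field_differentiable_bound[OF convex_cball _ L(2) that])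
      fix x assume "x \<in> cball (y1 r0) \<delta>"
      then show "(f has_field_derivative deriv f x) (at x within cball (y1 r0) \<delta>)"
        using \<delta>(2) U has_field_derivative_at_within holomorphic_derivI by blast
    qed auto
    obtain d1 where d1: "d1 > 0" "\<And>r. r \<in> I \<Longrightarrow> dist r r0 < d1 \<Longrightarrow> dist (y1 r) (y1 r0) < \<delta>"
      using cont(1) r0(1) \<delta>(1) unfolding continuous_on_iff by metis
    obtain d2 where d2: "d2 > 0" "\<And>r. r \<in> I \<Longrightarrow> dist r r0 < d2 \<Longrightarrow> dist (y2 r) (y2 r0) < \<delta>"
      using cont(2) r0(1) \<delta>(1) unfolding continuous_on_iff by metis
    \<comment> \<open>Within \<open>d\<close> both solutions stay in the ball where \<open>L\<close>
      is a Lipschitz constant, and \<open>L * d \<le> 1 / 2\<close>. At the point \<open>m\<close>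
      of largest distance \<open>?M\<close> this gives \<open>?M \<le> ?M / 2\<close>, so
      \<open>?M\<close> is zero.\<close>
    define d where "d = min (min d1 d2) (1 / (2 * L))"
    have d: "d > 0" "d \<le> d1" "d \<le> d2" "d \<le> 1 / (2 * L)"
      unfolding d_def using d1(1) d2(1) L(1) by auto
    then have Ld: "L * d \<le> 1 / 2" using L(1) by (simp add: field_simps)
    have "y1 r = y2 r" if r: "r \<in> I" "dist r r0 < d" for r
    proof -
      define J where "J = closed_segment r0 r"
      have JI: "J \<subseteq> I" unfolding J_def using I r r0 is_interval_convex closed_segment_subset by blast
      have near: "\<bar>s - r0\<bar> < d" if "s \<in> J" for s
        using that r(2) unfolding J_def closed_segment_eq_real_ivl by (auto simp: dist_real_def split: if_splits)
      have inb: "y1 s \<in> cball (y1 r0) \<delta>" "y2 s \<in> cball (y1 r0) \<delta>" if "s \<in> J" for s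
        using near[OF that] d d1(2)[of s] d2(2)[of s] JI that r0(2)
        by (auto simp: dist_real_def dist_commute less_imp_le)
      have "continuous_on J (\<lambda>s. norm (y1 s - y2 s))"
        using cont JI by (intro continuous_intros) (auto intro: continuous_on_subset)
      then obtain m where m: "m \<in> J" "\<And>s. s \<in> J \<Longrightarrow> norm (y1 s - y2 s) \<le> norm (y1 m - y2 m)"
        using continuous_attains_sup[of J "\<lambda>s. norm (y1 s - y2 s)"] unfolding J_def by auto
      let ?M = "norm (y1 m - y2 m)"
      have "norm ((y1 m - y2 m) - (y1 r0 - y2 r0)) \<le> (L * ?M) * \<bar>m - r0\<bar>"
      proof (rule vector_derivative_bound[of J])
        show "((\<lambda>s. y1 s - y2 s) has_vector_derivative f (y1 s) - f (y2 s)) (at s within J)" if "s \<in> J" for s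
          using y1[of s] y2[of s] that JI
          by (intro has_vector_derivative_diff) (auto intro: has_vector_derivative_within_subset)
        show "norm (f (y1 s) - f (y2 s)) \<le> L * ?M" if "s \<in> J" for s
          using lip[OF inb[OF that]] m(2)[OF that] L(1)
          by (meson mult_left_mono less_imp_le order_trans)
      qed (use m in \<open>auto simp: J_def\<close>)
      then have "?M \<le> (L * ?M) * \<bar>m - r0\<bar>" using r0(2) by simp
      also have "\<dots> \<le> (L * ?M) * d" using near[OF m(1)] L(1) by (intro mult_left_mono) auto
      also have "\<dots> = (L * d) * ?M" by simp
      also have "\<dots> \<le> (1 / 2) * ?M" using Ld by (intro mult_right_mono) auto
      finally have "?M \<le> 0" by simp
      moreover have "norm (y1 r - y2 r) \<le> ?M" by (rule m) (simp add: J_def)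
      ultimately show ?thesis by simp
    qed
    with d(1) show ?thesis by blast
  qed
  have "openin (top_of_set I) {r \<in> I. y1 r = y2 r}"
    unfolding openin_euclidean_subtopology_iff using open_eq by (auto simp: dist_commute)
  moreover have "closedin (top_of_set I) {r \<in> I. y1 r = y2 r}"
    using continuous_closedin_preimage_constant[OF continuous_on_diff[OF cont], of 0] by simp
  moreover have "connected I" using I is_interval_connected by blast
  ultimately have "{r \<in> I. y1 r = y2 r} = I" using a connected_clopen by blast
  with \<open>b \<in> I\<close> show ?thesis by blast
qed

text \<open>If \<open>a\<close> were nonzero, the linear part would dominate the error near
  \<open>t\<close> and \<open>f\<close> would have no zeros there. This allows an identity known
  only at times accumulating at \<open>t\<close> to be differentiated at \<open>t\<close>.\<close>

lemma has_vector_derivative_frequently_zero: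
  fixes f :: "real \<Rightarrow> 'a::real_normed_vector"
  assumes "(f has_vector_derivative a) (at t)" "f t = 0" "\<exists>\<^sub>F s in at t. f s = 0"
  shows "a = 0"
proof (rule ccontr)
  assume "a \<noteq> 0"
  have "((\<lambda>y. (1 / norm (y - t)) *\<^sub>R (f y - (f t + (y - t) *\<^sub>R a))) \<longlongrightarrow> 0) (at t)"
    using assms(1) unfolding has_vector_derivative_def has_derivative_within by simp
  then have "\<forall>\<^sub>F y in at t. norm ((1 / norm (y - t)) *\<^sub>R (f y - (f t + (y - t) *\<^sub>R a))) < norm a"
    using \<open>a \<noteq> 0\<close> by (simp add: tendsto_iff)
  then have "\<forall>\<^sub>F y in at t. f y \<noteq> 0"
    using eventually_neq_at_within[of t t UNIV]
    by eventually_elim (auto simp: assms(2))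
  with assms(3) show False by (simp add: frequently_def)
qed

section \<open>Potentials and equipotential curves\<close>

lemma is_potential_subset: "is_potential \<omega> V \<phi> \<Longrightarrow> U \<subseteq> V \<Longrightarrow> is_potential \<omega> U \<phi>"
  by (auto simp: is_potential_def)

lemma is_potential_holomorphic: "is_potential \<omega> V \<phi> \<Longrightarrow> \<phi> holomorphic_on V"
  unfolding is_potential_def holomorphic_on_def field_differentiable_def
  using has_field_derivative_at_within by blast

lemma potentials_differ_by_constant:
  assumes "open V" "connected V" "is_potential \<omega> V \<phi>" "is_potential \<omega> V \<psi>" "z \<in> V" "w \<in> V"
  shows "\<phi> w - \<phi> z = \<psi> w - \<psi> z"
proof -
  have "continuous_on V (\<lambda>w. \<phi> w - \<psi> w)"
    using assms by (intro holomorphic_on_imp_continuous_on holomorphic_intros is_potential_holomorphic)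
  moreover have "\<forall>w\<in>V - {}. ((\<lambda>w. \<phi> w - \<psi> w) has_field_derivative 0) (at w)"
    using assms(3,4) by (auto simp: is_potential_def intro!: derivative_eq_intros)
  ultimately obtain c where "\<And>w. w \<in> V \<Longrightarrow> \<phi> w - \<psi> w = c"
    using DERIV_zero_connected_constant[OF assms(2,1) finite.emptyI] by blast
  from this[OF assms(5)] this[OF assms(6)] show ?thesis by (simp add: algebra_simps)
qed

text \<open>By the chain rule \<open>Re (\<phi> (c s))\<close> has derivative
  \<open>Re (\<omega> (c s) * X)\<close>, which is zero on an equipotential curve.\<close>

lemma equipotential_curve_Re_constant:
  assumes "equipotential_curve \<omega> c J" "is_potential \<omega> V \<phi>" "c ` J \<subseteq> V" "a \<in> J" "b \<in> J"
  shows "Re (\<phi> (c b)) = Re (\<phi> (c a))"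
proof -
  have "norm (Re (\<phi> (c b)) - Re (\<phi> (c a))) \<le> 0 * \<bar>b - a\<bar>"
  proof (rule vector_derivative_bound[of J "\<lambda>s. Re (\<phi> (c s))" "\<lambda>_. 0"])
    show "convex J" using assms(1) by (simp add: equipotential_curve_def is_interval_convex)
    fix s assume s: "s \<in> J"
    obtain X where X: "(c has_vector_derivative X) (at s)" "Re (\<omega> (c s) * X) = 0"
      using assms(1) s unfolding equipotential_curve_def by blast
    have "(\<phi> has_field_derivative \<omega> (c s)) (at (c s))"
      using assms(2,3) s by (auto simp: is_potential_def)
    from field_vector_diff_chain_at[OF X(1) this]
    have "((\<lambda>s. \<phi> (c s)) has_vector_derivative X * \<omega> (c s)) (at s)" by (simp add: o_def)
    from bounded_linear.has_vector_derivative[OF bounded_linear_Re this]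
    show "((\<lambda>s. Re (\<phi> (c s))) has_vector_derivative 0) (at s within J)"
      using X(2) by (auto simp: mult.commute intro: has_vector_derivative_at_within)
  qed (use assms in auto)
  then show ?thesis by simp
qed

subsection \<open>The flow\<close>

context schwarz_group
begin

text \<open>Openness of the joint domain, put in filter form so that time and point may vary
  together.\<close>

lemma eventually_in_domain:
  assumes "t \<in> T" "z \<in> D t" "(f \<longlongrightarrow> t) F" "(g \<longlongrightarrow> z) F"
  shows "\<forall>\<^sub>F x in F. f x \<in> T \<and> g x \<in> D (f x)"
  using topological_tendstoD[OF tendsto_Pair[OF assms(3,4)] open_domain] assms(1,2) by simp

lemma box_in_domain:
  assumes "t \<in> T" "z \<in> D t"
  obtains r where "r > 0" "\<And>s w. \<bar>s - t\<bar> \<le> r \<Longrightarrow> dist z w \<le> r \<Longrightarrow> s \<in> T \<and> w \<in> D s"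
proof -
  obtain e where e: "e > 0" "cball (t, z) e \<subseteq> {(t, z). t \<in> T \<and> z \<in> D t}"
    using open_domain assms open_contains_cball[of "{(t, z). t \<in> T \<and> z \<in> D t}"]
    by (metis (mono_tags, lifting) case_prodI mem_Collect_eq)
  have "s \<in> T \<and> w \<in> D s" if "\<bar>s - t\<bar> \<le> e / 2" "dist z w \<le> e / 2" for s w
  proof -
    have "dist (t, z) (s, w) \<le> \<bar>dist t s\<bar> + \<bar>dist z w\<bar>"
      unfolding dist_Pair_Pair by (rule sqrt_sum_squares_le_sum_abs)
    also have "\<dots> \<le> e" using that by (simp add: dist_real_def abs_minus_commute)
    finally show ?thesis using e(2) by auto
  qed
  with e(1) show thesis by (intro that[of "e / 2"]) auto
qed

lemma tendsto_S:
  assumes "t \<in> T" "z \<in> D t" "(f \<longlongrightarrow> t) F" "(g \<longlongrightarrow> z) F"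
  shows "((\<lambda>x. S (f x) (g x)) \<longlongrightarrow> S t z) F"
proof -
  have "isCont (\<lambda>(t, z). S t z) (t, z)"
    using continuous open_domain assms(1,2) by (simp add: continuous_on_eq_continuous_at)
  from isCont_tendsto_compose[OF this tendsto_Pair[OF assms(3,4)]] show ?thesis by simp
qed

lemma scale_time: "t \<in> T \<Longrightarrow> 0 \<le> r \<Longrightarrow> r \<le> 1 \<Longrightarrow> r * t \<in> T"
  using convexD_alt[OF is_interval_convex[OF times(2)] times(3), of t r] by simp

lemma open_D: "t \<in> T \<Longrightarrow> open (D t)"
  using open_vimage[OF open_domain, of "\<lambda>z. (t, z)"] by (simp add: vimage_def continuous_on_Pair)

lemma D_subset: "t \<in> T \<Longrightarrow> D t \<subseteq> D 0"
  using time_interval[of t _ 0] by auto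

lemma real_in_domain: "t \<in> T \<Longrightarrow> x \<in> \<real> \<Longrightarrow> x \<in> D t"
  using real_axis by blast

lemma cnj_in_D_0 [simp]: "cnj z \<in> D 0 \<longleftrightarrow> z \<in> D 0"
  using domain_0(2) by (metis complex_cnj_cnj imageI)

lemma holomorphic_S: "t \<in> T \<Longrightarrow> S t holomorphic_on D t"
  using schwarz by (simp add: is_schwarz_function_def)

lemma S_has_derivative: "t \<in> T \<Longrightarrow> z \<in> D t \<Longrightarrow> (S t has_field_derivative deriv (S t) z) (at z)"
  using holomorphic_S open_D holomorphic_derivI by blast

lemma time_derivative_0:
  assumes "z \<in> D 0"
  shows "((\<lambda>s. S s z) has_vector_derivative - 2 * \<i> * generator S z) (at 0)"
proof -
  have "- 2 * \<i> * generator S z = vector_derivative (\<lambda>s. S s z) (at 0)"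
    by (simp add: generator_def flip: mult.assoc)
  then show ?thesis
    using time_differentiable[OF times(3) assms] vector_derivative_works by metis
qed

lemma autonomous_ode:
  assumes t: "t \<in> T" and z: "z \<in> D t"
  shows "((\<lambda>s. S s z) has_vector_derivative - 2 * \<i> * generator S (S t z)) (at t)"
proof (rule has_vector_derivative_shift)
  have w: "S t z \<in> D 0" using into_domain[OF t z] .
  \<comment> \<open>The group law is given only where both sides are defined; as the joint domain is
    open, this is so for all small \<open>h\<close>.\<close>
  have "\<forall>\<^sub>F h in nhds 0. S h (S t z) = S (t + h) z"
  proof -
    have "((\<lambda>h. t + h) \<longlongrightarrow> t) (nhds 0)"
      by (rule tendsto_eq_intros refl filterlim_ident | simp)+
    from eventually_in_domain[OF t z this tendsto_const]
      eventually_in_domain[OF times(3) w filterlim_ident tendsto_const]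
    show ?thesis
      by eventually_elim (use group_add[of _ t z] t z in \<open>auto simp: add.commute\<close>)
  qed
  then show "((\<lambda>h. S (t + h) z) has_vector_derivative - 2 * \<i> * generator S (S t z)) (at 0)"
    by (rule has_vector_derivative_cong_ev[OF time_derivative_0[OF w]])
qed

text \<open>The small time is now in the inner factor: the derivative passes through the holomorphic
  map \<open>S t\<close>, and the generator is taken at the starting point.\<close>

lemma linear_pde:
  assumes t: "t \<in> T" and z: "z \<in> D t"
  shows "((\<lambda>s. S s z) has_vector_derivative - 2 * \<i> * generator S z * deriv (S t) z) (at t)"
proof (rule has_vector_derivative_shift)
  have z0: "z \<in> D 0" using D_subset t z by auto
  have ev: "\<forall>\<^sub>F h in nhds 0. S t (S h z) = S (t + h) z"
  proof -
    have "((\<lambda>h. t + h) \<longlongrightarrow> t) (nhds 0)"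
      by (rule tendsto_eq_intros refl filterlim_ident | simp)+
    note ev1 = eventually_in_domain[OF t z this tendsto_const]
    have "((\<lambda>h. S h z) \<longlongrightarrow> z) (nhds 0)"
      using tendsto_S[OF times(3) z0 filterlim_ident tendsto_const] group_0[OF z0] by simp
    from topological_tendstoD[OF this open_D[OF t] z] ev1
      eventually_in_domain[OF times(3) z0 filterlim_ident tendsto_const]
    show ?thesis
      by eventually_elim (use group_add[of t _ z] t in simp)
  qed
  have "((S t \<circ> (\<lambda>h. S h z)) has_vector_derivative - 2 * \<i> * generator S z * deriv (S t) z) (at 0)"
    by (rule field_vector_diff_chain_at[OF time_derivative_0[OF z0]])
       (use S_has_derivative[OF t z] group_0[OF z0] in simp)
  then show "((\<lambda>h. S (t + h) z) has_vector_derivative - 2 * \<i> * generator S z * deriv (S t) z) (at 0)"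
    by (rule has_vector_derivative_cong_ev) (simp add: ev)
qed

text \<open>Two expressions for the same time derivative are compared: the flow carries the
  holomorphic field to itself. Off the zeros of the field, the dual differential is then invariant
  too.\<close>

lemma generator_S:
  assumes "t \<in> T" "z \<in> D t"
  shows "generator S (S t z) = generator S z * deriv (S t) z"
  using vector_derivative_unique_at[OF autonomous_ode[OF assms] linear_pde[OF assms]] by simp

text \<open>The difference quotients \<open>(S h z - z) / h\<close> are holomorphic in
  \<open>z\<close>. Uniform continuity of the time derivative on a compact box makes them converge
  uniformly near each point, so the limit is holomorphic.\<close>

lemma generator_holomorphic: "generator S holomorphic_on D 0"
proof -
  let ?d = "\<lambda>t z. vector_derivative (\<lambda>s. S s z) (at t)"
  have "generator S field_differentiable at z0" if z0: "z0 \<in> D 0" for z0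
  proof -
    obtain r where r0: "r > 0" and box: "\<And>s w. \<bar>s - 0\<bar> \<le> r \<Longrightarrow> dist z0 w \<le> r \<Longrightarrow> s \<in> T \<and> w \<in> D s"
      using box_in_domain[OF times(3) z0] by blast
    then have r: "r > 0" "{0..r} \<times> cball z0 r \<subseteq> {(t, z). t \<in> T \<and> z \<in> D t}"
      by auto
    have "uniformly_continuous_on ({0..r} \<times> cball z0 r) (\<lambda>(t, z). ?d t z)"
      using r(2) time_derivative_continuous
      by (intro compact_uniformly_continuous compact_Times) (auto intro: continuous_on_subset)
    note uc = this[unfolded uniformly_continuous_on_def, rule_format]
    \<comment> \<open>Positive times in the box tending to 0. The derivative at time 0 is known to
      exist, so one sequence identifies it.\<close>
    define h where "h n = r / real (Suc n)" for n
    have h: "0 < h n" "h n \<le> r" for n using r(1) by (auto simp: h_def field_simps)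
    have "h \<longlonglongrightarrow> 0" unfolding h_def using tendsto_mult[OF tendsto_const LIMSEQ_inverse_real_of_nat, of r] by (simp add: field_simps)
    define F where "F n z = (S (h n) z - z) / of_real (h n)" for n z
    have lim: "uniform_limit (cball z0 r) F (?d 0) sequentially"
    proof (rule uniform_limitI)
      fix e :: real assume "e > 0"
      then obtain \<delta> where \<delta>: "\<delta> > 0" and near:
        "\<And>p q. p \<in> {0..r} \<times> cball z0 r \<Longrightarrow> q \<in> {0..r} \<times> cball z0 r \<Longrightarrow> dist q p < \<delta> \<Longrightarrow>
           dist ((\<lambda>(t, z). ?d t z) q) ((\<lambda>(t, z). ?d t z) p) < e / 2"
        using uc[of "e / 2"] by (metis half_gt_zero)
      have "\<forall>\<^sub>F n in sequentially. h n < \<delta>"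
        using \<open>h \<longlonglongrightarrow> 0\<close> \<delta> by (simp add: order_tendsto_iff)
      then show "\<forall>\<^sub>F n in sequentially. \<forall>z\<in>cball z0 r. dist (F n z) (?d 0 z) < e"
      proof eventually_elim
        case (elim n)
        show ?case
        proof
          fix z assume z: "z \<in> cball z0 r"
          \<comment> \<open>On \<open>{0..h n}\<close> the time derivative stays within
            \<open>e / 2\<close> of its value at 0, which bounds the deviation of the increment from
            the linear one.\<close>
          have "norm (S (h n) z - S 0 z - (h n - 0) *\<^sub>R ?d 0 z) \<le> norm (h n - 0) * (e / 2)"
          proof (rule vector_differentiable_bound_linearization[of "{0..h n}" "\<lambda>s. S s z" "\<lambda>s. ?d s z"])
            fix s assume s: "s \<in> {0..h n}"
            then have "(s, z) \<in> {0..r} \<times> cball z0 r" using h(2)[of n] z by auto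
            then have "(\<lambda>s. S s z) differentiable (at s)"
              using r(2) time_differentiable by blast
            then have "((\<lambda>s. S s z) has_vector_derivative ?d s z) (at s)"
              using vector_derivative_works by blast
            then show "((\<lambda>s. S s z) has_vector_derivative ?d s z) (at s within {0..h n})"
              by (rule has_vector_derivative_at_within)
            have "dist (?d s z) (?d 0 z) < e / 2"
              using near[of "(0, z)" "(s, z)"] s h(2)[of n] z elim r(1) by (auto simp: dist_Pair_Pair)
            then show "norm (?d s z - ?d 0 z) \<le> e / 2" by (simp add: dist_norm)
          qed (use h[of n] in \<open>auto simp: closed_segment_eq_real_ivl\<close>)
          moreover have "z \<in> D 0" using r z by force
          ultimately have "norm (S (h n) z - z - of_real (h n) * ?d 0 z) \<le> h n * (e / 2)"
            using h(1)[of n] by (simp add: group_0 scaleR_conv_of_real)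
          moreover have "F n z - ?d 0 z = (S (h n) z - z - of_real (h n) * ?d 0 z) / of_real (h n)"
            using h(1)[of n] by (simp add: F_def field_simps)
          ultimately have "dist (F n z) (?d 0 z) \<le> e / 2"
            using h(1)[of n] by (simp only: dist_norm norm_divide norm_of_real abs_of_pos pos_divide_le_eq mult.commute)
          then show "dist (F n z) (?d 0 z) < e" using \<open>e > 0\<close> by simp
        qed
      qed
    qed
    have "?d 0 holomorphic_on ball z0 r"
    proof (rule holomorphic_uniform_sequence[of _ F])
      fix n
      have "h n \<in> T" "ball z0 r \<subseteq> D (h n)" using box[of "h n" z0] box[of "h n"] r0 h[of n] by (auto simp: less_imp_le)
      then show "F n holomorphic_on ball z0 r"
        unfolding F_def using h(1)[of n] holomorphic_on_subset[OF holomorphic_S]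
        by (intro holomorphic_intros) simp_all
    next
      fix x assume "x \<in> ball z0 r"
      then obtain d where "d > 0" "cball x d \<subseteq> ball z0 r" using open_contains_cball[THEN iffD1, OF open_ball] by blast
      then show "\<exists>d>0. cball x d \<subseteq> ball z0 r \<and> uniform_limit (cball x d) F (?d 0) sequentially"
        using uniform_limit_on_subset[OF lim] ball_subset_cball by blast
    qed auto
    then have "generator S holomorphic_on ball z0 r"
      unfolding generator_def by (intro holomorphic_intros)
    then show ?thesis using r(1) holomorphic_on_imp_differentiable_at by fastforce
  qed
  then show ?thesis
    using holomorphic_on_def field_differentiable_at_within by blast
qed

section \<open>Uniqueness of trajectories and injectivity of the flow maps\<close>

lemma affine_time_path:
  assumes "a + b * r \<in> T" "z \<in> D (a + b * r)"
  shows "S (a + b * r) z \<in> D 0"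
    and "((\<lambda>r. S (a + b * r) z) has_vector_derivative
           - 2 * \<i> * of_real b * generator S (S (a + b * r) z)) (at r)"
proof -
  show "S (a + b * r) z \<in> D 0" using into_domain assms .
  have "((\<lambda>r. a + b * r) has_vector_derivative b) (at r)"
    by (auto intro!: derivative_eq_intros simp: has_real_derivative_iff_has_vector_derivative[symmetric])
  from vector_diff_chain_at[OF this autonomous_ode[OF assms]]
  show "((\<lambda>r. S (a + b * r) z) has_vector_derivative
           - 2 * \<i> * of_real b * generator S (S (a + b * r) z)) (at r)"
    by (simp add: o_def scaleR_conv_of_real mult_ac)
qed

text \<open>Trajectories run forwards, backwards or at half speed are compared through this. The
  rates \<open>c\<close> and \<open>c'\<close> are kept apart, and times such as
  \<open>0 + t * r\<close> are left unsimplified later, so that the equations from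
  \<open>affine_time_path\<close> fit literally.\<close>

lemma flow_unique:
  assumes "c = c'" "is_interval I" "a \<in> I" "y1 a = y2 a" "b \<in> I"
    and "\<And>r. r \<in> I \<Longrightarrow> y1 r \<in> D 0 \<and> (y1 has_vector_derivative c * generator S (y1 r)) (at r)"
    and "\<And>r. r \<in> I \<Longrightarrow> y2 r \<in> D 0 \<and> (y2 has_vector_derivative c' * generator S (y2 r)) (at r)"
  shows "y1 b = y2 b"
proof (rule autonomous_ode_unique[of "D 0" "\<lambda>w. c * generator S w" I])
  show "open (D 0)" using open_D times(3) .
  show "(\<lambda>w. c * generator S w) holomorphic_on D 0"
    by (intro holomorphic_intros generator_holomorphic)
qed (use assms in \<open>auto intro: has_vector_derivative_at_within\<close>)

text \<open>\<open>S t z\<close> need not lie in \<open>D (- t)\<close>, so \<open>S (- t)\<close>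
  is not at hand as a left inverse. Instead the two trajectories, equal at \<open>r = 1\<close>, are
  followed back to \<open>r = 0\<close> by uniqueness.\<close>

lemma inj_on_S:
  assumes t: "t \<in> T"
  shows "inj_on (S t) (D t)"
proof (rule inj_onI)
  fix z w assume z: "z \<in> D t" and w: "w \<in> D t" and eq: "S t z = S t w"
  have "S (0 + t * 0) z = S (0 + t * 0) w"
  proof (rule flow_unique[OF refl, of "{0..1}" 1 "\<lambda>r. S (0 + t * r) z" "\<lambda>r. S (0 + t * r) w" 0
        "- 2 * \<i> * of_real t"])
    fix r :: real assume "r \<in> {0..1}"
    then have "0 + t * r \<in> T" "z \<in> D (0 + t * r)" "w \<in> D (0 + t * r)"
      using scale_time[OF t, of r] time_interval[OF t, of _ r] z w by (auto simp: mult.commute)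
    then show "S (0 + t * r) z \<in> D 0 \<and> ((\<lambda>r. S (0 + t * r) z) has_vector_derivative
           - 2 * \<i> * of_real t * generator S (S (0 + t * r) z)) (at r)"
      "S (0 + t * r) w \<in> D 0 \<and> ((\<lambda>r. S (0 + t * r) w) has_vector_derivative
           - 2 * \<i> * of_real t * generator S (S (0 + t * r) w)) (at r)"
      by (blast intro: affine_time_path)+
  qed (use eq in \<open>auto simp: is_interval_cc\<close>)
  moreover have "z \<in> D 0" "w \<in> D 0" using D_subset t z w by auto
  ultimately show "z = w" using group_0 by simp
qed

lemma deriv_S_nonzero: "t \<in> T \<Longrightarrow> z \<in> D t \<Longrightarrow> deriv (S t) z \<noteq> 0"
  using holomorphic_injective_imp_regular holomorphic_S open_D inj_on_S by blast

lemma analytic_param_S: "t \<in> T \<Longrightarrow> analytic_param (S t) (D t)"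
  using open_D real_axis holomorphic_S inj_on_S deriv_S_nonzero by (simp add: analytic_param_def)

lemma schwarz_curve_nonempty:
  assumes "t \<in> T"
  obtains p where "p \<in> schwarz_curve (S t) (D t)"
proof -
  obtain \<gamma> :: "complex \<Rightarrow> complex" where "\<gamma> ` \<real> = schwarz_curve (S t) (D t)"
    using schwarz[OF assms] unfolding is_schwarz_function_def by blast
  then show thesis using that[of "\<gamma> 0"] by force
qed

subsection \<open>Reflection symmetry of the generator\<close>

text \<open>Since \<open>S t (\<gamma> w) = cnj (\<gamma> (cnj w))\<close>, the reflection
  \<open>z \<mapsto> cnj (S t z)\<close> is \<open>w \<mapsto> cnj w\<close> in the parameter, an
  involution of the symmetric set \<open>N\<close>.\<close>

lemma schwarz_involution_near_curve:
  assumes "t \<in> T" "p \<in> schwarz_curve (S t) (D t)"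
  obtains U where "open U" "p \<in> U" "\<And>z. z \<in> U \<Longrightarrow> S t (cnj (S t z)) = cnj z"
proof -
  obtain \<gamma> N where \<gamma>: "analytic_param \<gamma> N" "cnj ` N = N" "\<gamma> ` \<real> = schwarz_curve (S t) (D t)"
      "\<forall>z\<in>\<gamma> ` N. S t z = conj_fun \<gamma> (inv_into N \<gamma> z)"
    using schwarz[OF assms(1)] unfolding is_schwarz_function_def by blast
  have N: "open N" "\<real> \<subseteq> N" "\<gamma> holomorphic_on N" "inj_on \<gamma> N"
    using \<gamma>(1) by (auto simp: analytic_param_def)
  show thesis
  proof
    show "open (\<gamma> ` N)" using N open_mapping_thm3 by blast
    show "p \<in> \<gamma> ` N" using assms(2) \<gamma>(3) N(2) by blast
    fix z assume "z \<in> \<gamma> ` N"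
    then obtain w where w: "w \<in> N" "z = \<gamma> w" by blast
    have S: "S t (\<gamma> u) = cnj (\<gamma> (cnj u))" if "u \<in> N" for u
      using \<gamma>(4) N(4) that by (simp add: conj_fun_def)
    have "cnj w \<in> N" using \<gamma>(2) w(1) by blast
    with w show "S t (cnj (S t z)) = cnj z" by (simp add: S)
  qed
qed

text \<open>Pick a point \<open>p t\<close> on each \<open>\<Gamma>\<^sub>t\<close>.  As there are uncountably many \<open>t\<close>, some
  \<open>(t, p t)\<close> is a limit point of the others.  Hence \<open>S s (cnj (S s z)) = cnj z\<close> holds on a fixed ball
  for \<open>s = t\<close> and a sequence of times converging to \<open>t\<close>, and it can be differentiated in \<open>s\<close> at \<open>t\<close>.\<close>

lemma generator_cnj:
  assumes "w \<in> D 0"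
  shows "cnj (generator S (cnj w)) = generator S w"
proof -
  define p where "p t = (SOME z. z \<in> schwarz_curve (S t) (D t))" for t
  have p: "p t \<in> schwarz_curve (S t) (D t)" if "t \<in> T" for t
    unfolding p_def using schwarz_curve_nonempty[OF that] by (metis someI_ex)
  have "uncountable T"
    using times(1,3) uncountable_ball[where 'a=real] open_contains_ball countable_subset by metis
  \<comment> \<open>The chosen points need not depend continuously on time or be distinct. Recording
    the time makes the pairs distinct, and any other pair near \<open>(t, p t)\<close> has a time
    different from \<open>t\<close>.\<close>
  moreover have "inj_on (\<lambda>t. (t, p t)) T" by (simp add: inj_on_def)
  ultimately have "uncountable ((\<lambda>t. (t, p t)) ` T)" using countable_image_inj_on by blast
  then obtain t where t: "t \<in> T" and lim: "(t, p t) islimpt ((\<lambda>t. (t, p t)) ` T)"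
    by (rule uncountable_has_internal_limit_point) auto
  define z0 where "z0 = p t"
  have z0: "z0 \<in> D t" "S t z0 = cnj z0" using p[OF t] by (auto simp: z0_def schwarz_curve_def)

  have S_lim: "((\<lambda>x. cnj (S (fst x) (snd x))) \<longlongrightarrow> z0) (nhds t \<times>\<^sub>F nhds z0)"
  proof -
    have "((\<lambda>x. cnj (S (fst x) (snd x))) \<longlongrightarrow> cnj (S t z0)) (nhds t \<times>\<^sub>F nhds z0)"
      by (intro tendsto_cnj tendsto_S t z0 filterlim_fst filterlim_snd)
    then show ?thesis using z0 by simp
  qed
  \<comment> \<open>One neighbourhood of \<open>t\<close> and one ball about \<open>z0\<close> serve
    all nearby times: there \<open>z\<close> and its reflection both stay in
    \<open>D s\<close>.\<close>
  have "\<forall>\<^sub>F x in nhds t \<times>\<^sub>F nhds z0. fst x \<in> T \<and> snd x \<in> D (fst x) \<and> cnj (S (fst x) (snd x)) \<in> D (fst x)"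
    using eventually_in_domain[OF t z0(1) filterlim_fst filterlim_snd]
      eventually_in_domain[OF t z0(1) filterlim_fst S_lim]
    by eventually_elim simp
  then obtain P Q where P: "\<forall>\<^sub>F s in nhds t. P s" and Q: "\<forall>\<^sub>F z in nhds z0. Q z"
    and PQ: "\<And>s z. P s \<Longrightarrow> Q z \<Longrightarrow> s \<in> T \<and> z \<in> D s \<and> cnj (S s z) \<in> D s"
    unfolding eventually_prod_filter fst_conv snd_conv by blast
  obtain r where r: "r > 0" "\<And>z. z \<in> ball z0 r \<Longrightarrow> Q z"
    using Q by (auto simp: eventually_nhds_metric dist_commute)

  \<comment> \<open>The involution is known only near \<open>p s\<close>, on a set that may shrink
    with \<open>s\<close>. As \<open>p s\<close> lies in the fixed ball, analytic continuation of
    the identity for \<open>cnj \<circ> S s \<circ> cnj \<circ> S s\<close> extends it to the whole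
    ball.\<close>
  have involution: "S s (cnj (S s z)) = cnj z" if s: "P s" "p s \<in> ball z0 r" and z: "z \<in> ball z0 r" for s z
  proof -
    have sT: "s \<in> T" using PQ r(2) s(1) z by blast
    obtain U where U: "open U" "p s \<in> U" "\<And>z. z \<in> U \<Longrightarrow> S s (cnj (S s z)) = cnj z"
      using schwarz_involution_near_curve[OF sT p[OF sT]] by blast
    have [simp]: "cnj ` cnj ` D s = D s" by (simp add: image_image)
    have "(cnj \<circ> S s \<circ> cnj) \<circ> S s holomorphic_on ball z0 r"
    proof (rule holomorphic_on_compose_gen)
      show "S s holomorphic_on ball z0 r"
        using holomorphic_S[OF sT] by (rule holomorphic_on_subset) (use PQ r(2) s(1) in blast)
      have "open (cnj ` D s)"
        unfolding image_cnj_conv_vimage_cnj using open_D[OF sT] by (intro open_vimage) auto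
      then show "cnj \<circ> S s \<circ> cnj holomorphic_on cnj ` D s"
        using holomorphic_S[OF sT] by (intro holomorphic_on_compose_cnj_cnj) auto
      show "S s ` ball z0 r \<subseteq> cnj ` D s"
        using PQ r(2) s(1) by (metis complex_cnj_cnj image_eqI image_subsetI)
    qed
    note hol = this
    have "((cnj \<circ> S s \<circ> cnj) \<circ> S s) z = z"
    proof (rule analytic_continuation_open[OF _ _ _ _ _ hol])
      show "open (U \<inter> ball z0 r)" "U \<inter> ball z0 r \<noteq> {}" using U s(2) by auto
      show "((cnj \<circ> S s \<circ> cnj) \<circ> S s) u = u" if "u \<in> U \<inter> ball z0 r" for u
        unfolding o_def using U(3)[of u] that by simp
    qed (use z in \<open>auto intro: holomorphic_intros\<close>)
    then have "cnj (S s (cnj (S s z))) = z" by simp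
    then show ?thesis by (metis complex_cnj_cnj)
  qed

  have Pt: "P t" using P by (rule eventually_nhds_x_imp_x)
  have z0r: "z0 \<in> ball z0 r" using r(1) by simp
  have freq: "\<exists>\<^sub>F s in at t. P s \<and> p s \<in> ball z0 r"
  proof -
    have "\<exists>\<^sub>F s in at t. p s \<in> ball z0 r"
      unfolding frequently_def eventually_at_topological
    proof safe
      fix V assume V: "open V" "t \<in> V" "\<forall>x\<in>V. x \<noteq> t \<longrightarrow> x \<in> UNIV \<longrightarrow> p x \<notin> ball z0 r"
      have "open (V \<times> ball z0 r)" "(t, p t) \<in> V \<times> ball z0 r"
        using V r(1) by (auto simp: open_Times z0_def)
      then obtain y where "y \<in> (\<lambda>t. (t, p t)) ` T" "y \<in> V \<times> ball z0 r" "y \<noteq> (t, p t)"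
        using lim unfolding islimpt_def by meson
      moreover from this obtain s where "y = (s, p s)" by blast
      ultimately have "s \<in> V" "s \<noteq> t" "p s \<in> ball z0 r" by auto
      with V(3) show False by blast
    qed
    moreover have "\<forall>\<^sub>F s in at t. P s" using P by (simp add: eventually_nhds_conv_at)
    ultimately show ?thesis by (rule frequently_eventually_conj)
  qed

  have symmetric: "cnj (generator S (cnj q)) = generator S q"
    if q: "q \<in> ball z0 r" "cnj (S t q) \<in> ball z0 r" for q
  proof -
    define z where "z = cnj (S t q)"
    have qD: "q \<in> D t" and zD: "z \<in> D t" using PQ[OF Pt] r(2) q by (auto simp: z_def)
    have Sz: "S t z = cnj q" using involution[OF Pt _ q(1)] z0r by (simp add: z_def z0_def)
    have cz: "cnj z \<in> D 0" using zD D_subset t by auto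
    \<comment> \<open>Applying \<open>S (t - s)\<close> to \<open>S s (cnj (S s z)) = cnj z\<close>
      gives \<open>S t (cnj (S s z)) = S (t - s) (cnj z)\<close>, so \<open>G\<close> vanishes at
      the good times near \<open>t\<close>. In the first term the outer map \<open>S t\<close> is
      fixed, so the chain rule applies.\<close>
    define G where "G s = S t (cnj (S s z)) - S (t - s) (cnj z)" for s
    have "((\<lambda>s. cnj (S s z)) has_vector_derivative cnj (- 2 * \<i> * generator S (S t z))) (at t)"
      by (intro has_vector_derivative_cnj autonomous_ode t zD)
    from field_vector_diff_chain_at[OF this, of "S t" "deriv (S t) q"]
    have 1: "((\<lambda>s. S t (cnj (S s z))) has_vector_derivative
        cnj (- 2 * \<i> * generator S (S t z)) * deriv (S t) q) (at t)"
      using S_has_derivative[OF t qD] by (simp add: Sz o_def)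
    have 2: "((\<lambda>s. S (t - s) (cnj z)) has_vector_derivative 2 * \<i> * generator S (cnj z)) (at t)"
      using affine_time_path(2)[of t "-1" t "cnj z"] times(3) cz group_0[OF cz] by simp
    have G': "(G has_vector_derivative cnj (- 2 * \<i> * generator S (S t z)) * deriv (S t) q
        - 2 * \<i> * generator S (cnj z)) (at t)"
      unfolding G_def by (intro has_vector_derivative_diff 1 2)
    have Gt: "G t = 0" using cz by (simp add: G_def Sz group_0) (simp add: z_def)
    have "\<forall>\<^sub>F s in at t. P s \<and> p s \<in> ball z0 r \<longrightarrow> G s = 0"
    proof -
      have "((\<lambda>s. S s z) \<longlongrightarrow> S t z) (at t)"
        using tendsto_S[OF t zD tendsto_ident_at tendsto_const] .
      then have "((\<lambda>s. cnj (S s z)) \<longlongrightarrow> q) (at t)" using tendsto_cnj by (fastforce simp: Sz)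
      from topological_tendstoD[OF this open_D[OF t] qD]
      have "\<forall>\<^sub>F s in at t. cnj (S s z) \<in> D t" .
      moreover have "((\<lambda>s. t - s) \<longlongrightarrow> 0) (at t)"
        using tendsto_diff[OF tendsto_const[of t] tendsto_ident_at[of t UNIV]] by simp
      from eventually_in_domain[OF times(3) cz this tendsto_const]
      have "\<forall>\<^sub>F s in at t. t - s \<in> T \<and> cnj z \<in> D (t - s)" .
      ultimately show ?thesis
      proof eventually_elim
        case (elim s)
        show ?case
        proof
          assume s: "P s \<and> p s \<in> ball z0 r"
          have zr: "z \<in> ball z0 r" using q(2) by (simp add: z_def)
          have "S s (cnj (S s z)) = cnj z" using involution s zr by blast
          moreover have "s \<in> T" "cnj (S s z) \<in> D s" using PQ r(2) s zr by blast+
          ultimately show "G s = 0"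
            using group_add[of "t - s" s "cnj (S s z)"] elim t by (simp add: G_def)
        qed
      qed
    qed
    then have "\<exists>\<^sub>F s in at t. G s = 0"
      using freq by (rule frequently_mp)
    from has_vector_derivative_frequently_zero[OF G' Gt this]
    have "cnj (- 2 * \<i> * generator S (S t z)) * deriv (S t) q = 2 * \<i> * generator S (cnj z)" by simp
    \<comment> \<open>As \<open>cnj z = S t q\<close>, invariance of the field produces the factor
      \<open>deriv (S t) q\<close> on this side as well; it cancels and leaves the symmetry at
      \<open>q\<close>.\<close>
    also have "generator S (cnj z) = generator S q * deriv (S t) q"
      using generator_S[OF t qD] by (simp add: z_def)
    finally show ?thesis using deriv_S_nonzero[OF t qD] by (simp add: Sz)
  qed

  have "(cnj \<circ> generator S \<circ> cnj) w = generator S w"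
  proof (rule analytic_continuation_open[where f = "cnj \<circ> generator S \<circ> cnj" and g = "generator S" and z = w])
    \<comment> \<open>This open set contains \<open>z0\<close>, which is its own reflection. The
      identity theorem on the connected symmetric set \<open>D 0\<close> then spreads the
      symmetry.\<close>
    let ?U = "(D t \<inter> S t -` (cnj ` ball z0 r)) \<inter> ball z0 r"
    have cb: "cnj ` ball z0 r = ball (cnj z0) r"
    proof -
      have "cmod (z0 - cnj x) = cmod (cnj z0 - x)" for x
        by (metis complex_cnj_cnj complex_cnj_diff complex_mod_cnj)
      then show ?thesis by (auto simp: image_cnj_conv_vimage_cnj dist_norm)
    qed
    have "continuous_on (D t) (S t)"
      using holomorphic_S[OF t] holomorphic_on_imp_continuous_on by blast
    then show "open ?U" unfolding cb
      by (intro open_Int continuous_open_preimage open_D[OF t] open_ball)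
    show "?U \<noteq> {}" using z0 z0r r(1) by (auto simp: cb)
    show "?U \<subseteq> D 0" using D_subset t by auto
    show "cnj \<circ> generator S \<circ> cnj holomorphic_on D 0"
      using generator_holomorphic open_D[OF times(3)] domain_0(2)
      by (intro holomorphic_on_compose_cnj_cnj) auto
    show "(cnj \<circ> generator S \<circ> cnj) q = generator S q" if "q \<in> ?U" for q
    proof -
      have "cnj (S t q) \<in> ball z0 r" using that by auto
      with that show ?thesis using symmetric by simp
    qed
  qed (use open_D times(3) domain_0(1) generator_holomorphic assms in auto)
  then show ?thesis by simp
qed

section \<open>Reflected trajectories and the curves as images of the real axis\<close>

lemma reflected_affine_time_path:
  assumes "a + b * r \<in> T" "z \<in> D (a + b * r)"
  shows "cnj (S (a + b * r) z) \<in> D 0"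
    and "((\<lambda>r. cnj (S (a + b * r) z)) has_vector_derivative
           2 * \<i> * of_real b * generator S (cnj (S (a + b * r) z))) (at r)"
  using affine_time_path[OF assms] has_vector_derivative_cnj[OF affine_time_path(2)[OF assms]]
    generator_cnj[of "cnj (S (a + b * r) z)"] by auto

text \<open>By the symmetry of the generator, conjugation reverses time. Both sides thus follow the
  same equation from the same real starting point.\<close>

lemma cnj_S_real:
  assumes t: "t \<in> T" and x: "x \<in> \<real>"
  shows "cnj (S t x) = S (- t) x"
proof -
  have "cnj (S (0 + t * 1) x) = S (0 + (- t) * 1) x"
  proof (rule flow_unique[of "2 * \<i> * of_real t" "- 2 * \<i> * of_real (- t)" "{0..1}" 0
        "\<lambda>r. cnj (S (0 + t * r) x)" "\<lambda>r. S (0 + (- t) * r) x" 1])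
    fix r :: real assume "r \<in> {0..1}"
    then have "t * r \<in> T" using scale_time[OF t, of r] by (simp add: mult.commute)
    then have "0 + t * r \<in> T" "0 + (- t) * r \<in> T" using times(4) by auto
    moreover from this have "x \<in> D (0 + t * r)" "x \<in> D (0 + (- t) * r)" using real_in_domain x by blast+
    ultimately show
      "cnj (S (0 + t * r) x) \<in> D 0 \<and> ((\<lambda>r. cnj (S (0 + t * r) x)) has_vector_derivative
         2 * \<i> * of_real t * generator S (cnj (S (0 + t * r) x))) (at r)"
      "S (0 + (- t) * r) x \<in> D 0 \<and> ((\<lambda>r. S (0 + (- t) * r) x) has_vector_derivative
         - 2 * \<i> * of_real (- t) * generator S (S (0 + (- t) * r) x)) (at r)"
      by (blast intro: affine_time_path reflected_affine_time_path)+
  next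
    have "x \<in> D 0" using x real_in_domain times(3) by blast
    then show "cnj (S (0 + t * 0) x) = S (0 + (- t) * 0) x"
      using x by (simp add: group_0 Reals_cnj_iff)
  qed (auto simp: is_interval_cc)
  then show ?thesis by simp
qed

lemma half_time: "t \<in> T \<Longrightarrow> t / 2 \<in> T" "t \<in> T \<Longrightarrow> - t / 2 \<in> T"
  using scale_time[of t "1 / 2"] scale_time[of "- t" "1 / 2"] times(4)[of t] by auto

text \<open>The reflection \<open>z \<mapsto> cnj (S t z)\<close> reverses the trajectory from \<open>z\<close> to \<open>S t z\<close>, so the midpoint
  \<open>S (t / 2) z\<close> of the trajectory of a point \<open>z\<close> of the curve is real.\<close>

lemma schwarz_curve_eq:
  assumes t: "t \<in> T"
  shows "schwarz_curve (S t) (D t) = S (- t / 2) ` \<real> \<inter> D t"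
proof (intro equalityI subsetI)
  fix z assume "z \<in> S (- t / 2) ` \<real> \<inter> D t"
  then obtain x where x: "x \<in> \<real>" "z = S (- t / 2) x" and z: "z \<in> D t" by blast
  \<comment> \<open>\<open>S t\<close> after \<open>S (- t / 2)\<close> leaves
    \<open>S (t / 2)\<close>, and at the real point \<open>x\<close> this is the conjugate of
    \<open>S (- t / 2) x\<close>, that is, of \<open>z\<close>.\<close>
  have "S t z = S (t / 2) x"
    using group_add[of t "- t / 2" x] half_time[OF t] t z x(2)
      real_in_domain[OF half_time(1)[OF t] x(1)] real_in_domain[OF half_time(2)[OF t] x(1)]
    by simp
  also have "\<dots> = cnj z"
    using cnj_S_real[OF half_time(2)[OF t] x(1)] x(2) by simp
  finally show "z \<in> schwarz_curve (S t) (D t)" using z by (simp add: schwarz_curve_def)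
next
  fix z assume "z \<in> schwarz_curve (S t) (D t)"
  then have z: "z \<in> D t" "cnj z = S t z" by (auto simp: schwarz_curve_def)
  have z0: "z \<in> D 0" using z D_subset t by auto
  \<comment> \<open>The two curves meet at \<open>r = 1\<close> because
    \<open>cnj z = S t z\<close>. Followed back to \<open>r = 1 / 2\<close>, they show that the
    midpoint equals its own conjugate.\<close>
  have mid: "S (0 + t * (1 / 2)) z = cnj (S (t + (- t) * (1 / 2)) z)"
  proof (rule flow_unique[of "- 2 * \<i> * of_real t" "2 * \<i> * of_real (- t)" "{0..1}" 1
        "\<lambda>r. S (0 + t * r) z" "\<lambda>r. cnj (S (t + (- t) * r) z)" "1 / 2"])
    fix r :: real assume r: "r \<in> {0..1}"
    have e: "t + (- t) * r = (1 - r) * t" by (simp add: algebra_simps)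
    have "0 + t * r \<in> T" "z \<in> D (0 + t * r)"
      using r scale_time[OF t, of r] time_interval[OF t z(1), of r] by (auto simp: mult.commute)
    moreover have "t + (- t) * r \<in> T" "z \<in> D (t + (- t) * r)"
      unfolding e using r scale_time[OF t, of "1 - r"] time_interval[OF t z(1), of "1 - r"] by auto
    ultimately show
      "S (0 + t * r) z \<in> D 0 \<and> ((\<lambda>r. S (0 + t * r) z) has_vector_derivative
         - 2 * \<i> * of_real t * generator S (S (0 + t * r) z)) (at r)"
      "cnj (S (t + (- t) * r) z) \<in> D 0 \<and> ((\<lambda>r. cnj (S (t + (- t) * r) z)) has_vector_derivative
         2 * \<i> * of_real (- t) * generator S (cnj (S (t + (- t) * r) z))) (at r)"
      by (blast intro: affine_time_path reflected_affine_time_path)+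
  next
    show "S (0 + t * 1) z = cnj (S (t + (- t) * 1) z)" using z(2)[symmetric] z0 by (simp add: group_0)
  qed (auto simp: is_interval_cc)
  have half: "0 + t * (1 / 2) = t / 2" "t + (- t) * (1 / 2) = t / 2" by simp_all
  define w where "w = S (t / 2) z"
  have w: "w \<in> \<real>"
    using mid[symmetric] unfolding half w_def Reals_cnj_iff .
  \<comment> \<open>Going back from the midpoint recovers \<open>z\<close>; being real,
    \<open>w\<close> lies in the domain at every time.\<close>
  have "S (0 + (- t / 2) * 1) w = S (t / 2 + (- t / 2) * 1) z"
  proof (rule flow_unique[OF refl, of "{0..1}" 0 "\<lambda>r. S (0 + (- t / 2) * r) w"
        "\<lambda>r. S (t / 2 + (- t / 2) * r) z" 1 "- 2 * \<i> * of_real (- t / 2)"])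
    fix r :: real assume r: "r \<in> {0..1}"
    have e: "t / 2 + (- t / 2) * r = ((1 - r) / 2) * t" by (simp add: field_simps)
    have "0 + (- t / 2) * r \<in> T"
      using r scale_time[OF half_time(2)[OF t], of r] by (simp add: mult.commute)
    moreover from this have "w \<in> D (0 + (- t / 2) * r)" using w by (rule real_in_domain)
    moreover have "t / 2 + (- t / 2) * r \<in> T" "z \<in> D (t / 2 + (- t / 2) * r)"
      unfolding e using r scale_time[OF t, of "(1 - r) / 2"] time_interval[OF t z(1), of "(1 - r) / 2"]
      by auto
    ultimately show
      "S (0 + (- t / 2) * r) w \<in> D 0 \<and> ((\<lambda>r. S (0 + (- t / 2) * r) w) has_vector_derivative
         - 2 * \<i> * of_real (- t / 2) * generator S (S (0 + (- t / 2) * r) w)) (at r)"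
      "S (t / 2 + (- t / 2) * r) z \<in> D 0 \<and> ((\<lambda>r. S (t / 2 + (- t / 2) * r) z) has_vector_derivative
         - 2 * \<i> * of_real (- t / 2) * generator S (S (t / 2 + (- t / 2) * r) z)) (at r)"
      by (blast intro: affine_time_path)+
  next
    have "w \<in> D 0" using w real_in_domain times(3) by blast
    then show "S (0 + (- t / 2) * 0) w = S (t / 2 + (- t / 2) * 0) z" by (simp add: group_0 w_def)
  qed (auto simp: is_interval_cc)
  then have "S (- t / 2) w = z" using z0 by (simp add: group_0)
  with w z show "z \<in> S (- t / 2) ` \<real> \<inter> D t" by blast
qed

text \<open>This is the quadrature: the dual differential takes the constant value -2 on the
  velocity of the flow. The function \<open>f\<close> compensates the resulting linear fall of the
  potential and so is constant.\<close>

lemma potential_along_flow: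
  assumes "V \<subseteq> {z \<in> D 0. generator S z \<noteq> 0}" "is_potential (dual_differential S) V \<phi>"
    and t: "t \<in> T" and z: "z \<in> D t" and path: "\<And>r. r \<in> {0..1} \<Longrightarrow> S (r * t) z \<in> V"
  shows "\<phi> (S t z) - \<phi> z = - 2 * of_real t"
proof -
  define f where "f r = \<phi> (S (0 + t * r) z) + of_real r * (2 * of_real t)" for r
  have "norm (f 1 - f 0) \<le> 0 * \<bar>1 - 0\<bar>"
  proof (rule vector_derivative_bound[of "{0..1}" f "\<lambda>r. 0"])
    fix r :: real assume r: "r \<in> {0..1}"
    let ?w = "S (0 + t * r) z"
    have dom: "0 + t * r \<in> T" "z \<in> D (0 + t * r)" and w: "?w \<in> V"
      using r scale_time[OF t, of r] time_interval[OF t z, of r] path[OF r] by (auto simp: mult.commute)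
    have "(\<phi> has_field_derivative dual_differential S ?w) (at ?w)"
      using assms(2) w by (simp add: is_potential_def)
    from field_vector_diff_chain_at[OF affine_time_path(2)[OF dom] this]
    have "((\<lambda>r. \<phi> (S (0 + t * r) z)) has_vector_derivative - 2 * of_real t) (at r)"
      using assms(1) w by (auto simp: o_def dual_differential_def)
    moreover have "((\<lambda>r. of_real r * (2 * of_real t)) has_vector_derivative 2 * complex_of_real t) (at r)"
      by (rule has_vector_derivative_real_field) (auto intro!: derivative_eq_intros)
    ultimately have "(f has_vector_derivative - 2 * of_real t + 2 * complex_of_real t) (at r)"
      unfolding f_def by (rule has_vector_derivative_add)
    then show "(f has_vector_derivative 0) (at r within {0..1})"
      by (auto intro: has_vector_derivative_at_within)
  qed auto
  then have "f 1 = f 0" by simp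
  moreover have "z \<in> D 0" using D_subset t z by auto
  ultimately show ?thesis by (simp add: f_def group_0 algebra_simps eq_neg_iff_add_eq_0)
qed

section \<open>Canonical parametrization and its normal velocity\<close>

lemma canonical_param_has_tangent:
  assumes "t \<in> T"
  shows "(canonical_param S t has_vector_derivative deriv (S (- t / 2)) (of_real x)) (at x)"
proof -
  have "of_real x \<in> D (- t / 2)" by (intro real_in_domain half_time assms) auto
  from has_vector_derivative_real_field[OF S_has_derivative[OF half_time(2)[OF assms] this]]
  show ?thesis by (simp add: canonical_param_def[abs_def])
qed

lemma canonical_param_tangent_nonzero: "t \<in> T \<Longrightarrow> deriv (S (- t / 2)) (of_real x) \<noteq> 0"
  using deriv_S_nonzero half_time(2) real_in_domain Reals_of_real by blast

text \<open>Reflection symmetry makes the generator real on the real axis, and invariance transports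
  its value to the curve. There it is a real multiple of the tangent, so \<open>\<i>\<close> times
  it is normal.\<close>

lemma generator_canonical_param:
  assumes "t \<in> T"
  obtains a where "generator S (of_real x) = of_real a"
    "generator S (canonical_param S t x) = of_real a * deriv (S (- t / 2)) (of_real x)"
proof -
  have x: "of_real x \<in> D (- t / 2)" "of_real x \<in> D 0"
    by (intro real_in_domain half_time assms times(3) Reals_of_real)+
  have "generator S (of_real x) \<in> \<real>"
    using generator_cnj[OF x(2)] by (simp add: Reals_cnj_iff)
  then show thesis
    using that generator_S[OF half_time(2)[OF assms] x(1)] by (auto simp: canonical_param_def elim: Reals_cases)
qed

text \<open>Running time at rate \<open>- 1 / 2\<close> turns the factor \<open>- 2 * \<i>\<close>
  of the flow into \<open>\<i>\<close>.\<close>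

lemma canonical_param_velocity:
  assumes "t \<in> T"
  shows "((\<lambda>s. canonical_param S s x) has_vector_derivative \<i> * generator S (canonical_param S t x)) (at t)"
proof -
  have "0 + (- 1 / 2) * t \<in> T" "of_real x \<in> D (0 + (- 1 / 2) * t)"
    using half_time(2)[OF assms] real_in_domain[OF half_time(2)[OF assms], of "of_real x"] by simp_all
  from affine_time_path(2)[OF this] show ?thesis
    by (simp add: canonical_param_def)
qed

lemma reflection_field_orthogonal:
  assumes "t \<in> T"
  shows "reflection_field S (canonical_param S t x) \<bullet> deriv (S (- t / 2)) (of_real x) = 0"
proof -
  obtain a where "generator S (canonical_param S t x) = of_real a * deriv (S (- t / 2)) (of_real x)"
    using generator_canonical_param[OF assms] by blast
  then show ?thesis by (simp add: reflection_field_def inner_complex_def algebra_simps)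
qed

lemma normal_velocity_canonical_param:
  assumes "t \<in> T"
  shows "normal_velocity (canonical_param S) t x = reflection_field S (canonical_param S t x)"
  using reflection_field_orthogonal[OF assms, of x]
    vector_derivative_at[OF canonical_param_has_tangent[OF assms, of x]]
    vector_derivative_at[OF canonical_param_velocity[OF assms, of x]]
  by (simp add: normal_velocity_def reflection_field_def)

subsection \<open>Equipotentials\<close>

text \<open>Isolated zeros of the generator become poles. If it vanishes identically, division by
  zero yields the zero differential, still meromorphic.\<close>

lemma dual_differential_meromorphic: "dual_differential S meromorphic_on D 0"
proof -
  have "generator S analytic_on D 0"
    using generator_holomorphic open_D[OF times(3)] by (simp add: analytic_on_open)
  then have "generator S meromorphic_on D 0" by (rule analytic_on_imp_meromorphic_on)
  then show ?thesis unfolding dual_differential_def[abs_def] by (intro meromorphic_intros)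
qed

text \<open>The sign comes from conjugating the factor \<open>\<i>\<close>. It makes
  \<open>cnj \<circ> \<phi> \<circ> cnj\<close> a potential of minus the differential.\<close>

lemma dual_differential_cnj:
  assumes "w \<in> D 0"
  shows "cnj (dual_differential S (cnj w)) = - dual_differential S w"
  using generator_cnj[OF assms] by (simp add: dual_differential_def)

lemma local_potential:
  assumes "z \<in> D 0" "generator S z \<noteq> 0"
  obtains r \<phi> where "r > 0" "ball z r \<subseteq> {w \<in> D 0. generator S w \<noteq> 0}"
    "is_potential (dual_differential S) (ball z r) \<phi>"
proof -
  have o: "open (D 0)" using open_D times(3) .
  have cont: "continuous_on (D 0) (generator S)"
    using generator_holomorphic holomorphic_on_imp_continuous_on by blast
  have "{w \<in> D 0. generator S w \<noteq> 0} = D 0 \<inter> generator S -` (- {0})" by auto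
  then have "open {w \<in> D 0. generator S w \<noteq> 0}"
    using continuous_open_preimage[OF cont o, of "- {0}"] by auto
  then obtain r where r: "r > 0" "ball z r \<subseteq> {w \<in> D 0. generator S w \<noteq> 0}"
    using assms open_contains_ball by blast
  have "generator S holomorphic_on ball z r"
    by (rule holomorphic_on_subset[OF generator_holomorphic]) (use r in blast)
  then have "dual_differential S holomorphic_on ball z r"
    unfolding dual_differential_def[abs_def] by (intro holomorphic_intros) (use r in auto)
  then obtain \<phi> where "\<And>w. w \<in> ball z r \<Longrightarrow> (\<phi> has_field_derivative dual_differential S w) (at w within ball z r)"
    using holomorphic_convex_primitive'[OF convex_ball open_ball] by metis
  then have "is_potential (dual_differential S) (ball z r) \<phi>"
    by (simp add: is_potential_def at_within_open[of _ "ball z r"])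
  with r show thesis by (rule that)
qed

text \<open>Near a point of \<open>\<Gamma>\<^sub>t\<close>, the function \<open>cnj (\<phi> (cnj (S u w))) + \<phi> w\<close> is
  \<open>2 u\<close> plus a constant: the equation of motion gives its \<open>u\<close>-derivative, and its \<open>w\<close>-derivative
  vanishes because \<open>\<omega>\<close> is invariant under the flow and changes sign under reflection.\<close>

lemma schwarz_curves_are_level_sets:
  assumes t: "t \<in> T" and z: "z \<in> schwarz_curve (S t) (D t)"
    and V: "open V" "z \<in> V" "V \<subseteq> {w \<in> D 0. generator S w \<noteq> 0}"
    and \<phi>: "is_potential (dual_differential S) V \<phi>"
  obtains e where "e > 0" "ball z e \<subseteq> V" "inj_on \<phi> (ball z e)"
    "\<And>u. \<bar>u - t\<bar> < e \<Longrightarrow> u \<in> T"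
    "\<And>u w. \<bar>u - t\<bar> < e \<Longrightarrow> w \<in> ball z e \<Longrightarrow>
       w \<in> schwarz_curve (S u) (D u) \<longleftrightarrow> Re (\<phi> w) = Re (\<phi> z) + (u - t)"
proof -
  let ?\<omega> = "dual_differential S"
  have zD: "z \<in> D t" "S t z = cnj z" using z by (auto simp: schwarz_curve_def)
  have d\<phi>: "(\<phi> has_field_derivative ?\<omega> w) (at w)" if "w \<in> V" for w
    using \<phi> that by (simp add: is_potential_def)
  \<comment> \<open>The differential has no zeros on \<open>V\<close>, so \<open>\<phi>\<close> is
    injective near \<open>z\<close> and points can be compared through their potentials.\<close>
  have "deriv \<phi> z \<noteq> 0"
    using DERIV_imp_deriv[OF d\<phi>[OF V(2)]] V(2,3) by (auto simp: dual_differential_def)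
  then obtain r where r: "r > 0" "ball z r \<subseteq> V" "inj_on \<phi> (ball z r)"
    using has_complex_derivative_locally_injective[OF is_potential_holomorphic[OF \<phi>] V(2,1)] by blast
  have "((\<lambda>x. cnj (S (fst x) (snd x))) \<longlongrightarrow> cnj (S t z)) (nhds t \<times>\<^sub>F nhds z)"
    by (intro tendsto_cnj tendsto_S t zD filterlim_fst filterlim_snd)
  then have "((\<lambda>x. cnj (S (fst x) (snd x))) \<longlongrightarrow> z) (nhds t \<times>\<^sub>F nhds z)" by (simp add: zD(2))
  from topological_tendstoD[OF this open_ball] r(1)
  have "\<forall>\<^sub>F x in nhds t \<times>\<^sub>F nhds z. cnj (S (fst x) (snd x)) \<in> ball z r" by simp
  then have "\<forall>\<^sub>F x in nhds t \<times>\<^sub>F nhds z.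
      fst x \<in> T \<and> snd x \<in> D (fst x) \<and> cnj (S (fst x) (snd x)) \<in> ball z r"
    using eventually_in_domain[OF t zD(1) filterlim_fst filterlim_snd] by eventually_elim simp
  then obtain P Q where P: "\<forall>\<^sub>F u in nhds t. P u" and Q: "\<forall>\<^sub>F w in nhds z. Q w"
    and PQ: "\<And>u w. P u \<Longrightarrow> Q w \<Longrightarrow> u \<in> T \<and> w \<in> D u \<and> cnj (S u w) \<in> ball z r"
    unfolding eventually_prod_filter fst_conv snd_conv by blast
  obtain e1 where e1: "e1 > 0" "\<And>u. dist u t < e1 \<Longrightarrow> P u"
    using P by (auto simp: eventually_nhds_metric)
  obtain e2 where e2: "e2 > 0" "\<And>w. dist w z < e2 \<Longrightarrow> Q w"
    using Q by (auto simp: eventually_nhds_metric)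
  define e where "e = min r (min e1 e2)"
  have e: "e > 0" "e \<le> r" "e \<le> e1" "e \<le> e2" using r e1 e2 by (auto simp: e_def)
  have box: "u \<in> T" "w \<in> D u" "cnj (S u w) \<in> ball z r" if "\<bar>u - t\<bar> < e" "w \<in> ball z e" for u w
    using PQ[OF e1(2) e2(2), of u w] that e by (auto simp: dist_real_def dist_commute)
  have sub: "ball z e \<subseteq> ball z r" using e(2) by auto
  define g where "g u w = cnj (\<phi> (cnj (S u w))) + \<phi> w" for u w
  have reflected: "((cnj \<circ> \<phi> \<circ> cnj) has_field_derivative - ?\<omega> (S u w)) (at (S u w))"
    and nz: "generator S (S u w) \<noteq> 0"
    if "\<bar>u - t\<bar> < e" "w \<in> ball z e" for u w
  proof -
    have in_V: "cnj (S u w) \<in> V" using box(3)[OF that] r(2) by blast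
    have D0: "S u w \<in> D 0" using into_domain box(1,2)[OF that] by blast
    show "((cnj \<circ> \<phi> \<circ> cnj) has_field_derivative - ?\<omega> (S u w)) (at (S u w))"
      using has_field_derivative_cnj_cnj[OF d\<phi>[OF in_V]] dual_differential_cnj[OF D0] by simp
    show "generator S (S u w) \<noteq> 0"
      using generator_cnj[OF D0] in_V V(3) by auto
  qed
  have g_w: "g u w = g u z" if u: "\<bar>u - t\<bar> < e" and w: "w \<in> ball z e" for u w
  proof -
    have "\<exists>c. \<forall>w\<in>ball z e. g u w = c"
    proof (rule has_field_derivative_zero_constant[OF convex_ball])
      fix w assume w: "w \<in> ball z e"
      have "((cnj \<circ> \<phi> \<circ> cnj) \<circ> S u has_field_derivative - ?\<omega> (S u w) * deriv (S u) w) (at w)"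
        by (intro DERIV_chain reflected[OF u w] S_has_derivative[OF box(1,2)[OF u w]])
      then have "(g u has_field_derivative - ?\<omega> (S u w) * deriv (S u) w + ?\<omega> w) (at w)"
        unfolding g_def o_def using w sub r(2) by (intro DERIV_add d\<phi>) auto
      moreover have "?\<omega> (S u w) * deriv (S u) w = ?\<omega> w"
        using generator_S[OF box(1,2)[OF u w]] nz[OF u w] by (simp add: dual_differential_def)
      ultimately show "(g u has_field_derivative 0) (at w within ball z e)"
        by (auto intro: has_field_derivative_at_within)
    qed
    then show ?thesis using w e(1) by force
  qed
  have g_u: "g u z = g t z + 2 * of_real (u - t)" if u: "\<bar>u - t\<bar> < e" for u
  proof -
    have ze: "z \<in> ball z e" using e(1) by simp
    have "norm ((g u z - of_real u * 2) - (g t z - of_real t * 2)) \<le> 0 * \<bar>u - t\<bar>"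
    proof (rule vector_derivative_bound[of "ball t e" "\<lambda>u. g u z - of_real u * 2" "\<lambda>_. 0"])
      fix s assume "s \<in> ball t e"
      then have s: "\<bar>s - t\<bar> < e" by (simp add: dist_real_def)
      note dom = box(1,2)[OF s ze]
      have "((\<lambda>u. cnj (\<phi> (cnj (S u z)))) has_vector_derivative
          - 2 * \<i> * generator S (S s z) * (- ?\<omega> (S s z))) (at s)"
        using field_vector_diff_chain_at[OF autonomous_ode[OF dom] reflected[OF s ze]]
        by (simp add: o_def)
      moreover have "- 2 * \<i> * generator S (S s z) * (- ?\<omega> (S s z)) = 2"
        using nz[OF s ze] by (simp add: dual_differential_def) (simp add: complex_eq_iff)
      ultimately have "((\<lambda>u. cnj (\<phi> (cnj (S u z)))) has_vector_derivative 2) (at s)" by (simp only:)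
      then have "((\<lambda>u. g u z) has_vector_derivative 2 + 0) (at s)"
        unfolding g_def by (intro has_vector_derivative_add has_vector_derivative_const)
      moreover have "((\<lambda>u. of_real u * 2) has_vector_derivative (2::complex)) (at s)"
        by (rule has_vector_derivative_real_field) (auto intro!: derivative_eq_intros)
      ultimately have "((\<lambda>u. g u z - of_real u * 2) has_vector_derivative 2 + 0 - 2) (at s)"
        by (rule has_vector_derivative_diff)
      then show "((\<lambda>u. g u z - of_real u * 2) has_vector_derivative 0) (at s within ball t e)"
        by (auto intro: has_vector_derivative_at_within)
    qed (use u e(1) in \<open>auto simp: dist_real_def\<close>)
    then show ?thesis by (simp add: algebra_simps)
  qed
  show thesis
  proof
    show "e > 0" by fact
    show "ball z e \<subseteq> V" using sub r(2) by blast
    show "inj_on \<phi> (ball z e)" using r(3) sub inj_on_subset by blast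
    show "u \<in> T" if "\<bar>u - t\<bar> < e" for u using box(1)[OF that, of z] e(1) by simp
    fix u w assume u: "\<bar>u - t\<bar> < e" and w: "w \<in> ball z e"
    \<comment> \<open>Points of the curve are those fixed by the reflection. Injectivity of
      \<open>\<phi>\<close> turns this into \<open>2 * Re (\<phi> w) = g u w\<close>, whose right
      side does not depend on \<open>w\<close>; at \<open>u = t\<close> and \<open>w = z\<close>,
      where the reflection fixes \<open>z\<close>, it equals
      \<open>2 * Re (\<phi> z)\<close>.\<close>
    have "w \<in> schwarz_curve (S u) (D u) \<longleftrightarrow> cnj w = S u w"
      using box(2)[OF u w] by (simp add: schwarz_curve_def)
    also have "\<dots> \<longleftrightarrow> w = cnj (S u w)" by (metis complex_cnj_cnj)
    also have "\<dots> \<longleftrightarrow> \<phi> w = \<phi> (cnj (S u w))"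
      using inj_on_eq_iff[OF r(3)] box(3)[OF u w] w sub by blast
    also have "\<dots> \<longleftrightarrow> cnj (\<phi> w) + \<phi> w = g u w"
      by (simp add: g_def)
    also have "g u w = cnj (\<phi> z) + \<phi> z + 2 * of_real (u - t)"
      using g_w[OF u w] g_u[OF u] by (simp add: g_def zD(2))
    also have "cnj (\<phi> w) + \<phi> w = \<dots> \<longleftrightarrow> Re (\<phi> w) = Re (\<phi> z) + (u - t)"
      by (auto simp: complex_eq_iff)
    finally show "w \<in> schwarz_curve (S u) (D u) \<longleftrightarrow> Re (\<phi> w) = Re (\<phi> z) + (u - t)" .
  qed
qed

text \<open>The level set description at \<open>u = t\<close> makes the real part locally constant
  on the curve; connectedness of \<open>K\<close> does the rest.\<close>

lemma Re_potential_constant_on_schwarz_curve: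
  assumes "open V" "V \<subseteq> {z \<in> D 0. generator S z \<noteq> 0}" "is_potential (dual_differential S) V \<phi>"
    and t: "t \<in> T" and K: "connected K" "K \<subseteq> schwarz_curve (S t) (D t) \<inter> V" and "a \<in> K" "b \<in> K"
  shows "Re (\<phi> a) = Re (\<phi> b)"
proof (rule connected_local_const[OF K(1) \<open>a \<in> K\<close> \<open>b \<in> K\<close>], intro ballI)
  fix z assume "z \<in> K"
  with K(2) have "z \<in> schwarz_curve (S t) (D t)" "z \<in> V" by auto
  then obtain e where e: "e > 0"
    "\<And>u w. \<bar>u - t\<bar> < e \<Longrightarrow> w \<in> ball z e \<Longrightarrow>
       w \<in> schwarz_curve (S u) (D u) \<longleftrightarrow> Re (\<phi> w) = Re (\<phi> z) + (u - t)"
    by (rule schwarz_curves_are_level_sets[OF t _ assms(1) _ assms(2,3)]) (rule that; assumption)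
  have "Re (\<phi> z) = Re (\<phi> w)" if "w \<in> K" "dist w z < e" for w
    using e(2)[of t w] e(1) K(2) that by (auto simp: dist_commute)
  then show "\<forall>\<^sub>F w in at z within K. Re (\<phi> z) = Re (\<phi> w)"
    unfolding eventually_at using e(1) by blast
qed

text \<open>Differentiating \<open>cnj (c s) = S t (c s)\<close> along a curve gives this relation,
  which confines tangent vectors to a single real line.\<close>

lemma tangent_vector_cnj:
  assumes t: "t \<in> T" and X: "X \<in> tangent_vectors (schwarz_curve (S t) (D t)) z"
  shows "cnj X = X * deriv (S t) z"
proof -
  obtain c e where c: "0 < e" "c ` {-e<..<e} \<subseteq> schwarz_curve (S t) (D t)" "c 0 = z"
      "(c has_vector_derivative X) (at (0::real))"
    using X by (auto simp: tangent_vectors_def)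
  have "z \<in> D t" using c(1-3) by (force simp: schwarz_curve_def)
  from field_vector_diff_chain_at[OF c(4), unfolded c(3), OF S_has_derivative[OF t this]]
  have "((\<lambda>s. S t (c s)) has_vector_derivative X * deriv (S t) z) (at 0)" by (simp add: o_def)
  moreover have "\<forall>\<^sub>F s in nhds 0. S t (c s) = cnj (c s)"
  proof -
    have "\<forall>\<^sub>F s in nhds 0. s \<in> {-e<..<e}" using c(1) by (intro eventually_nhds_in_open) auto
    then show ?thesis
      by eventually_elim (use c(2) in \<open>force simp: schwarz_curve_def\<close>)
  qed
  ultimately have "((\<lambda>s. cnj (c s)) has_vector_derivative X * deriv (S t) z) (at 0)"
    by (rule has_vector_derivative_cong_ev)
  with has_vector_derivative_cnj[OF c(4)] show ?thesis
    by (rule vector_derivative_unique_at)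
qed

text \<open>As \<open>generator S z\<close> is a nonzero real multiple of the tangent
  \<open>X0\<close>, the equation says exactly that \<open>X / X0\<close> is real. Real multiples of
  \<open>X0\<close> arise by reparametrizing, and \<open>tangent_vector_cnj\<close> excludes
  others.\<close>

lemma tangent_vectors_schwarz_curve:
  assumes t: "t \<in> T" and z: "z \<in> schwarz_curve (S t) (D t)" and nz: "generator S z \<noteq> 0"
  shows "tangent_vectors (schwarz_curve (S t) (D t)) z = {X. Re (dual_differential S z * X) = 0}"
proof -
  obtain x where x: "z = canonical_param S t x"
    using z schwarz_curve_eq[OF t] by (auto simp: canonical_param_def elim!: Reals_cases)
  define X0 where "X0 = deriv (S (- t / 2)) (of_real x)"
  have X0: "X0 \<noteq> 0" using canonical_param_tangent_nonzero[OF t] by (simp add: X0_def)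
  obtain a where a: "generator S z = of_real a * X0"
    using generator_canonical_param[OF t, of x] by (metis X0_def x)
  have "a \<noteq> 0" using a nz by auto
  have real_multiple: "k *\<^sub>R X0 \<in> tangent_vectors (schwarz_curve (S t) (D t)) z" for k
  proof -
    define c where "c s = canonical_param S t (x + k * s)" for s
    have "((\<lambda>s. x + k * s) has_vector_derivative k) (at 0)"
      by (auto intro!: derivative_eq_intros simp: has_real_derivative_iff_has_vector_derivative[symmetric])
    from vector_diff_chain_at[OF this, of "canonical_param S t" X0]
    have deriv: "(c has_vector_derivative k *\<^sub>R X0) (at 0)"
      using canonical_param_has_tangent[OF t, of x] by (simp add: o_def c_def[abs_def] X0_def)
    have "z \<in> D t" using z by (simp add: schwarz_curve_def)
    moreover have "(c \<longlongrightarrow> c 0) (nhds 0)"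
      using has_vector_derivative_continuous[OF deriv] by (simp add: continuous_at tendsto_nhds_iff)
    moreover have "c 0 = z" by (simp add: c_def x)
    \<comment> \<open>The curve is only the part of the image of the real axis inside
      \<open>D t\<close>, so the parameter interval is shrunk to stay there.\<close>
    ultimately have "\<forall>\<^sub>F s in nhds 0. c s \<in> D t"
      using topological_tendstoD[OF _ open_D[OF t]] by metis
    then obtain e where e: "e > 0" "\<And>s. dist s 0 < e \<Longrightarrow> c s \<in> D t"
      unfolding eventually_nhds_metric by blast
    have "c ` {-e<..<e} \<subseteq> schwarz_curve (S t) (D t)"
    proof
      fix w assume "w \<in> c ` {-e<..<e}"
      then obtain s where s: "w = c s" "\<bar>s\<bar> < e" by auto
      then show "w \<in> schwarz_curve (S t) (D t)"
        using e(2)[of s] unfolding schwarz_curve_eq[OF t] by (auto simp: c_def canonical_param_def)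
    qed
    with deriv e(1) \<open>c 0 = z\<close> show ?thesis by (auto simp: tangent_vectors_def)
  qed
  show ?thesis
  proof (intro equalityI subsetI)
    fix X assume X: "X \<in> tangent_vectors (schwarz_curve (S t) (D t)) z"
    have "X0 \<in> tangent_vectors (schwarz_curve (S t) (D t)) z" using real_multiple[of 1] by simp
    then have "cnj X0 = X0 * deriv (S t) z" by (rule tangent_vector_cnj[OF t])
    moreover from this have "deriv (S t) z \<noteq> 0" using X0 by auto
    ultimately have "cnj (X / X0) = X / X0"
      using tangent_vector_cnj[OF t X] by simp
    then have "X / X0 \<in> \<real>" by (simp add: Reals_cnj_iff)
    then obtain k where "X / X0 = of_real k" by (auto elim: Reals_cases)
    then have "X = of_real k * X0" using X0 by (simp add: field_simps)
    then show "X \<in> {X. Re (dual_differential S z * X) = 0}"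
      using X0 \<open>a \<noteq> 0\<close> by (simp add: dual_differential_def a Re_divide)
  next
    fix X assume "X \<in> {X. Re (dual_differential S z * X) = 0}"
    moreover define q where "q = X / X0"
    ultimately have "Re (q / (\<i> * of_real a)) = 0"
      by (simp add: dual_differential_def a mult_ac)
    then have "Im q = 0" using \<open>a \<noteq> 0\<close> by (simp add: Re_divide power2_eq_square)
    then have "q = of_real (Re q)" by (simp add: complex_eq_iff)
    moreover have "X = q * X0" using X0 by (simp add: q_def)
    ultimately have "X = Re q *\<^sub>R X0" by (metis scaleR_conv_of_real)
    then show "X \<in> tangent_vectors (schwarz_curve (S t) (D t)) z" using real_multiple by metis
  qed
qed

text \<open>The potential is a coordinate from \<open>V\<close> onto a disc in which the curves are
  pieces of vertical lines, one line for each time. Covering, connectedness and the shape of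
  equipotential curves are read off there.\<close>

lemma equipotential_chart:
  assumes t: "t \<in> T" and z: "z \<in> schwarz_curve (S t) (D t)" and nz: "generator S z \<noteq> 0"
  defines "\<omega> \<equiv> dual_differential S" and "\<Gamma> \<equiv> \<lambda>t. schwarz_curve (S t) (D t)"
  shows "\<exists>V e. open V \<and> connected V \<and> z \<in> V \<and> V \<subseteq> {w \<in> D 0. generator S w \<noteq> 0} \<and>
            0 < e \<and> {t-e<..<t+e} \<subseteq> T \<and>
            V \<subseteq> (\<Union>u\<in>{t-e<..<t+e}. \<Gamma> u) \<and>
            (\<forall>u\<in>{t-e<..<t+e}. connected (\<Gamma> u \<inter> V)) \<and>
            (\<forall>c J. equipotential_curve \<omega> c J \<and> c ` J \<subseteq> V \<longrightarrow>
               (\<exists>u\<in>{t-e<..<t+e}. c ` J \<subseteq> \<Gamma> u)) \<and>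
            (\<exists>\<phi>. is_potential \<omega> V \<phi>) \<and>
            (\<forall>\<phi>. is_potential \<omega> V \<phi> \<longrightarrow>
               (\<exists>C :: real \<Rightarrow> real. inj_on C {t-e<..<t+e} \<and>
                  (\<forall>u\<in>{t-e<..<t+e}. \<Gamma> u \<inter> V = {w \<in> V. Re (\<phi> w) = C u})))"
proof -
  have "z \<in> D 0" using z D_subset t by (auto simp: schwarz_curve_def)
  from local_potential[OF this nz]
  obtain r \<phi> where r: "r > 0" "ball z r \<subseteq> {w \<in> D 0. generator S w \<noteq> 0}"
    and \<phi>: "is_potential \<omega> (ball z r) \<phi>" unfolding \<omega>_def by blast
  have zr: "z \<in> ball z r" using r(1) by simp
  obtain e where e: "e > 0" "ball z e \<subseteq> ball z r" "inj_on \<phi> (ball z e)"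
    and eT: "\<And>u. \<bar>u - t\<bar> < e \<Longrightarrow> u \<in> T"
    and level: "\<And>u w. \<bar>u - t\<bar> < e \<Longrightarrow> w \<in> ball z e \<Longrightarrow> w \<in> \<Gamma> u \<longleftrightarrow> Re (\<phi> w) = Re (\<phi> z) + (u - t)"
    by (rule schwarz_curves_are_level_sets[OF t z open_ball zr r(2) \<phi>[unfolded \<omega>_def]])
       (rule that[unfolded \<Gamma>_def]; assumption)
  have hol: "\<phi> holomorphic_on ball z e"
    using is_potential_holomorphic[OF \<phi>] e(2) holomorphic_on_subset by blast
  obtain \<psi> where \<psi>: "\<psi> holomorphic_on \<phi> ` ball z e" "\<And>w. w \<in> ball z e \<Longrightarrow> \<psi> (\<phi> w) = w"
    using holomorphic_has_inverse[OF hol open_ball e(3)] by metis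
  have "open (\<phi> ` ball z e)" using open_mapping_thm3[OF hol open_ball e(3)] .
  then obtain \<rho>' where \<rho>': "\<rho>' > 0" "ball (\<phi> z) \<rho>' \<subseteq> \<phi> ` ball z e"
    using open_contains_ball e(1) by (metis centre_in_ball imageI)
  \<comment> \<open>The disc must lie in the image of \<open>\<phi>\<close>, and
    \<open>\<rho> \<le> e\<close> ensures that each value of \<open>Re \<phi>\<close> on
    \<open>V\<close> belongs to a time in the window.\<close>
  define \<rho> where "\<rho> = min \<rho>' e"
  have \<rho>: "\<rho> > 0" "ball (\<phi> z) \<rho> \<subseteq> \<phi> ` ball z e" "\<rho> \<le> e" using \<rho>' e(1) by (auto simp: \<rho>_def)
  define V where "V = ball z e \<inter> \<phi> -` ball (\<phi> z) \<rho>"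
  have V: "V \<subseteq> ball z e" by (simp add: V_def)
  have cont: "continuous_on (ball (\<phi> z) \<rho>) \<psi>"
    using \<psi>(1) \<rho>(2) holomorphic_on_imp_continuous_on continuous_on_subset by blast
  \<comment> \<open>This reduces connectedness of pieces of \<open>V\<close> to convexity of pieces
    of the disc.\<close>
  have V_image: "V \<inter> {w. \<phi> w \<in> A} = \<psi> ` (ball (\<phi> z) \<rho> \<inter> A)" for A
  proof (intro equalityI subsetI)
    fix w assume w: "w \<in> V \<inter> {w. \<phi> w \<in> A}"
    then have "\<psi> (\<phi> w) = w" "\<phi> w \<in> ball (\<phi> z) \<rho> \<inter> A" using \<psi>(2) by (auto simp: V_def)
    then show "w \<in> \<psi> ` (ball (\<phi> z) \<rho> \<inter> A)" by (metis imageI)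
  next
    fix w assume "w \<in> \<psi> ` (ball (\<phi> z) \<rho> \<inter> A)"
    then obtain y where y: "w = \<psi> y" "y \<in> ball (\<phi> z) \<rho>" "y \<in> A" by blast
    then obtain w' where "w' \<in> ball z e" "y = \<phi> w'" using \<rho>(2) by blast
    then show "w \<in> V \<inter> {w. \<phi> w \<in> A}" using y \<psi>(2) by (auto simp: V_def)
  qed
  have conn: "connected (V \<inter> {w. \<phi> w \<in> A})" if "convex A" for A
    unfolding V_image using that cont
    by (intro connected_continuous_image convex_connected convex_Int convex_ball)
       (auto intro: continuous_on_subset)
  have connV: "connected V" using conn[OF convex_UNIV] by simp
  have openV: "open V"
    unfolding V_def using holomorphic_on_imp_continuous_on[OF hol]
    by (intro continuous_open_preimage) auto
  have \<phi>V: "is_potential \<omega> V \<phi>" using is_potential_subset[OF \<phi>] V e(2) by blast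
  have zV: "z \<in> V" using e(1) \<rho>(1) by (simp add: V_def)
  have \<Gamma>V: "\<Gamma> u \<inter> V = {w \<in> V. Re (\<phi> w) = Re (\<phi> z) + (u - t)}" if "\<bar>u - t\<bar> < e" for u
    using level[OF that] V by blast
  \<comment> \<open>The time at which the moving curve passes through \<open>w\<close>, solved from
    the level set equation.\<close>
  define time where "time w = t + (Re (\<phi> w) - Re (\<phi> z))" for w
  have time: "\<bar>time w - t\<bar> < e" "w \<in> \<Gamma> (time w)" if "w \<in> V" for w
  proof -
    have "\<bar>Re (\<phi> w) - Re (\<phi> z)\<bar> \<le> norm (\<phi> w - \<phi> z)" using abs_Re_le_cmod[of "\<phi> w - \<phi> z"] by simp
    also have "\<dots> < e" using that \<rho>(3) by (simp add: V_def dist_norm norm_minus_commute)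
    finally show *: "\<bar>time w - t\<bar> < e" by (simp add: time_def)
    show "w \<in> \<Gamma> (time w)" using \<Gamma>V[OF *] that by (auto simp: time_def)
  qed
  have interval: "u \<in> {t-e<..<t+e} \<longleftrightarrow> \<bar>u - t\<bar> < e" for u by auto
  show ?thesis
  proof (intro exI[of _ V] exI[of _ e] conjI allI impI ballI)
    show "V \<subseteq> {w \<in> D 0. generator S w \<noteq> 0}" using V e(2) r(2) by blast
    show "{t-e<..<t+e} \<subseteq> T" by (rule subsetI) (simp only: interval eT)
    show "V \<subseteq> (\<Union>u\<in>{t-e<..<t+e}. \<Gamma> u)"
      by (rule subsetI) (rule UN_I, simp only: interval, erule time(1), erule time(2))
    show "connected (\<Gamma> u \<inter> V)" if "u \<in> {t-e<..<t+e}" for u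
    proof -
      have u: "\<bar>u - t\<bar> < e" using that by (simp only: interval)
      have "convex {y. Re y = Re (\<phi> z) + (u - t)}"
        using convex_hyperplane[of "1::complex" "Re (\<phi> z) + (u - t)"] by (simp add: inner_complex_def)
      from conn[OF this] have "connected (V \<inter> {w. Re (\<phi> w) = Re (\<phi> z) + (u - t)})" by simp
      moreover have "V \<inter> {w. Re (\<phi> w) = Re (\<phi> z) + (u - t)} = \<Gamma> u \<inter> V" unfolding \<Gamma>V[OF u] by blast
      ultimately show ?thesis by simp
    qed
    show "\<exists>u\<in>{t-e<..<t+e}. c ` J \<subseteq> \<Gamma> u" if c: "equipotential_curve \<omega> c J \<and> c ` J \<subseteq> V" for c J
    proof (cases "J = {}")
      case True
      then show ?thesis using e(1) by (intro bexI[of _ t]) auto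
    next
      case False
      then obtain s0 where s0: "s0 \<in> J" by blast
      have "c s \<in> \<Gamma> (time (c s0))" if s: "s \<in> J" for s
      proof -
        have "time (c s) = time (c s0)"
          using equipotential_curve_Re_constant[of \<omega> c J V \<phi> s0 s] c \<phi>V s0 s by (simp add: time_def)
        moreover have "c s \<in> V" using c s by blast
        ultimately show ?thesis using time(2)[of "c s"] by simp
      qed
      moreover have "c s0 \<in> V" using c s0 by blast
      then have "time (c s0) \<in> {t-e<..<t+e}" unfolding interval by (rule time(1))
      ultimately show ?thesis by blast
    qed
    show "\<exists>\<phi>. is_potential \<omega> V \<phi>" using \<phi>V by blast
    fix \<eta> assume \<eta>: "is_potential \<omega> V \<eta>"
    \<comment> \<open>On the connected set \<open>V\<close> any other potential differs from
      \<open>\<phi>\<close> by a constant, so its level sets are the same, with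
      \<open>C u = Re (\<eta> z) + (u - t)\<close>.\<close>
    have diff: "\<eta> w - \<eta> z = \<phi> w - \<phi> z" if "w \<in> V" for w
      using potentials_differ_by_constant[OF openV connV \<eta> \<phi>V zV that] .
    have "Re (\<phi> w) = Re (\<phi> z) + (u - t) \<longleftrightarrow> Re (\<eta> w) = Re (\<eta> z) + (u - t)" if "w \<in> V" for w u
      using arg_cong[OF diff[OF that], of Re] by (simp only: minus_complex.simps) linarith
    then have level_\<eta>: "\<Gamma> u \<inter> V = {w \<in> V. Re (\<eta> w) = Re (\<eta> z) + (u - t)}" if "\<bar>u - t\<bar> < e" for u
      unfolding \<Gamma>V[OF that] by blast
    show "\<exists>C :: real \<Rightarrow> real. inj_on C {t-e<..<t+e} \<and>
        (\<forall>u\<in>{t-e<..<t+e}. \<Gamma> u \<inter> V = {w \<in> V. Re (\<eta> w) = C u})"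
    proof (intro exI[of _ "\<lambda>u. Re (\<eta> z) + (u - t)"] conjI ballI)
      show "inj_on (\<lambda>u. Re (\<eta> z) + (u - t)) {t-e<..<t+e}" by (simp add: inj_on_def)
      show "\<Gamma> u \<inter> V = {w \<in> V. Re (\<eta> w) = Re (\<eta> z) + (u - t)}" if "u \<in> {t-e<..<t+e}" for u
        using that unfolding interval by (rule level_\<eta>)
    qed
  qed (fact openV connV zV e(1))+
qed

end

section \<open>Assembly of the flow equations, the quadrature, the normal velocity and the
  equipotentials\<close>

theorem theorem2:
  fixes T :: "real set" and D :: "real \<Rightarrow> complex set" and S :: "real \<Rightarrow> complex \<Rightarrow> complex"
    and v W \<omega> :: "complex \<Rightarrow> complex" and \<gamma> :: "real \<Rightarrow> real \<Rightarrow> complex"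
    and \<Gamma> :: "real \<Rightarrow> complex set"
  assumes S: "schwarz_group T D S"
    and v: "v = generator S"
    and W: "W = reflection_field S"
    and \<omega>: "\<omega> = dual_differential S"
    and \<gamma>: "\<gamma> = canonical_param S"
    and \<Gamma>: "\<Gamma> = (\<lambda>t. schwarz_curve (S t) (D t))"
  shows
    "(v holomorphic_on D 0 \<and>
      (\<forall>t\<in>T. \<forall>z\<in>D t.
         ((\<lambda>s. S s z) has_vector_derivative - 2 * \<i> * v z * deriv (S t) z) (at t))) \<and>

     ((\<forall>z\<in>D 0. S 0 z = z) \<and>
      (\<forall>t\<in>T. \<forall>z\<in>D t. ((\<lambda>s. S s z) has_vector_derivative - 2 * \<i> * v (S t z)) (at t)) \<and>
      (\<forall>V \<phi>. open V \<and> V \<subseteq> {z \<in> D 0. v z \<noteq> 0} \<and> is_potential \<omega> V \<phi> \<longrightarrow>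
         (\<forall>t\<in>T. \<forall>z\<in>D t. (\<forall>r\<in>{0..1}. S (r * t) z \<in> V) \<longrightarrow>
            \<phi> (S t z) - \<phi> z = - 2 * of_real t))) \<and>

     ((\<forall>x. \<gamma> 0 x = of_real x) \<and>
      (\<forall>t\<in>T. \<forall>x. ((\<lambda>s. \<gamma> s x) has_vector_derivative \<i> * v (\<gamma> t x)) (at t)) \<and>
      (\<forall>t\<in>T. analytic_param (S (- t / 2)) (D (- t / 2))) \<and>
      (\<forall>t\<in>T. \<Gamma> t = range (\<gamma> t) \<inter> D t)) \<and>

     ((\<forall>t\<in>T. \<forall>x. \<exists>X. X \<noteq> 0 \<and> (\<gamma> t has_vector_derivative X) (at x) \<and> W (\<gamma> t x) \<bullet> X = 0) \<and>
      (\<forall>t\<in>T. \<forall>x. normal_velocity \<gamma> t x = W (\<gamma> t x))) \<and>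

     (\<omega> meromorphic_on D 0 \<and>
      (\<forall>z\<in>D 0. v z \<noteq> 0 \<longrightarrow> \<omega> z * W z = 1) \<and>
      (\<forall>t\<in>T. \<forall>z\<in>\<Gamma> t. v z \<noteq> 0 \<longrightarrow> tangent_vectors (\<Gamma> t) z = {X. Re (\<omega> z * X) = 0}) \<and>
      (\<forall>t\<in>T. \<forall>z\<in>\<Gamma> t. v z \<noteq> 0 \<longrightarrow>
         (\<exists>V e. open V \<and> connected V \<and> z \<in> V \<and> V \<subseteq> {w \<in> D 0. v w \<noteq> 0} \<and>
            0 < e \<and> {t-e<..<t+e} \<subseteq> T \<and>
            V \<subseteq> (\<Union>u\<in>{t-e<..<t+e}. \<Gamma> u) \<and>
            (\<forall>u\<in>{t-e<..<t+e}. connected (\<Gamma> u \<inter> V)) \<and>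
            (\<forall>c J. equipotential_curve \<omega> c J \<and> c ` J \<subseteq> V \<longrightarrow>
               (\<exists>u\<in>{t-e<..<t+e}. c ` J \<subseteq> \<Gamma> u)) \<and>
            (\<exists>\<phi>. is_potential \<omega> V \<phi>) \<and>
            (\<forall>\<phi>. is_potential \<omega> V \<phi> \<longrightarrow>
               (\<exists>C :: real \<Rightarrow> real. inj_on C {t-e<..<t+e} \<and>
                  (\<forall>u\<in>{t-e<..<t+e}. \<Gamma> u \<inter> V = {w \<in> V. Re (\<phi> w) = C u}))))) \<and>
      (\<forall>V \<phi>. open V \<and> V \<subseteq> {z \<in> D 0. v z \<noteq> 0} \<and> is_potential \<omega> V \<phi> \<longrightarrow>
         (\<forall>t\<in>T. \<forall>K. connected K \<and> K \<subseteq> \<Gamma> t \<inter> V \<longrightarrow> (\<exists>C. \<forall>z\<in>K. Re (\<phi> z) = C))))"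
proof -
  interpret schwarz_group T D S by (rule S)
  have pde: "v holomorphic_on D 0 \<and>
      (\<forall>t\<in>T. \<forall>z\<in>D t.
         ((\<lambda>s. S s z) has_vector_derivative - 2 * \<i> * v z * deriv (S t) z) (at t))"
    using generator_holomorphic linear_pde by (simp add: v)
  have a: "(\<forall>z\<in>D 0. S 0 z = z) \<and>
      (\<forall>t\<in>T. \<forall>z\<in>D t. ((\<lambda>s. S s z) has_vector_derivative - 2 * \<i> * v (S t z)) (at t)) \<and>
      (\<forall>V \<phi>. open V \<and> V \<subseteq> {z \<in> D 0. v z \<noteq> 0} \<and> is_potential \<omega> V \<phi> \<longrightarrow>
         (\<forall>t\<in>T. \<forall>z\<in>D t. (\<forall>r\<in>{0..1}. S (r * t) z \<in> V) \<longrightarrow>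
            \<phi> (S t z) - \<phi> z = - 2 * of_real t))"
    unfolding v \<omega>
  proof (intro conjI ballI allI impI)
    show "S 0 z = z" if "z \<in> D 0" for z by (rule group_0[OF that])
    show "((\<lambda>s. S s z) has_vector_derivative - 2 * \<i> * generator S (S t z)) (at t)"
      if "t \<in> T" "z \<in> D t" for t z by (rule autonomous_ode[OF that])
    fix V \<phi> t z
    assume "open V \<and> V \<subseteq> {z \<in> D 0. generator S z \<noteq> 0} \<and> is_potential (dual_differential S) V \<phi>"
      "t \<in> T" "z \<in> D t" "\<forall>r\<in>{0..1}. S (r * t) z \<in> V"
    then show "\<phi> (S t z) - \<phi> z = - 2 * of_real t"
      by (intro potential_along_flow[of V]) auto
  qed
  have b: "(\<forall>x. \<gamma> 0 x = of_real x) \<and>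
      (\<forall>t\<in>T. \<forall>x. ((\<lambda>s. \<gamma> s x) has_vector_derivative \<i> * v (\<gamma> t x)) (at t)) \<and>
      (\<forall>t\<in>T. analytic_param (S (- t / 2)) (D (- t / 2))) \<and>
      (\<forall>t\<in>T. \<Gamma> t = range (\<gamma> t) \<inter> D t)"
  proof (intro conjI ballI allI)
    show "\<gamma> 0 x = of_real x" for x
      using group_0[OF real_in_domain[OF times(3) Reals_of_real]] by (simp add: \<gamma> canonical_param_def)
    show "((\<lambda>s. \<gamma> s x) has_vector_derivative \<i> * v (\<gamma> t x)) (at t)" if "t \<in> T" for t x
      unfolding \<gamma> v by (rule canonical_param_velocity[OF that])
    show "analytic_param (S (- t / 2)) (D (- t / 2))" if "t \<in> T" for t
      by (rule analytic_param_S[OF half_time(2)[OF that]])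
    show "\<Gamma> t = range (\<gamma> t) \<inter> D t" if "t \<in> T" for t
      unfolding \<Gamma> \<gamma> schwarz_curve_eq[OF that]
      by (simp add: canonical_param_def Reals_def image_image)
  qed
  have c: "(\<forall>t\<in>T. \<forall>x. \<exists>X. X \<noteq> 0 \<and> (\<gamma> t has_vector_derivative X) (at x) \<and> W (\<gamma> t x) \<bullet> X = 0) \<and>
      (\<forall>t\<in>T. \<forall>x. normal_velocity \<gamma> t x = W (\<gamma> t x))"
  proof (intro conjI ballI allI)
    show "\<exists>X. X \<noteq> 0 \<and> (\<gamma> t has_vector_derivative X) (at x) \<and> W (\<gamma> t x) \<bullet> X = 0" if "t \<in> T" for t x
      unfolding \<gamma> W
      by (intro exI[of _ "deriv (S (- t / 2)) (of_real x)"] conjI canonical_param_has_tangent canonical_param_tangent_nonzero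
          reflection_field_orthogonal that)
    show "normal_velocity \<gamma> t x = W (\<gamma> t x)" if "t \<in> T" for t x
      unfolding \<gamma> W by (rule normal_velocity_canonical_param[OF that])
  qed
  have dual: "\<forall>z\<in>D 0. v z \<noteq> 0 \<longrightarrow> \<omega> z * W z = 1"
    by (simp add: v \<omega> W dual_differential_def reflection_field_def)
  have tangent: "\<forall>t\<in>T. \<forall>z\<in>\<Gamma> t. v z \<noteq> 0 \<longrightarrow> tangent_vectors (\<Gamma> t) z = {X. Re (\<omega> z * X) = 0}"
    unfolding v \<omega> \<Gamma> by (intro ballI impI tangent_vectors_schwarz_curve)
  have const_Re: "\<forall>V \<phi>. open V \<and> V \<subseteq> {z \<in> D 0. v z \<noteq> 0} \<and> is_potential \<omega> V \<phi> \<longrightarrow>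
      (\<forall>t\<in>T. \<forall>K. connected K \<and> K \<subseteq> \<Gamma> t \<inter> V \<longrightarrow> (\<exists>C. \<forall>z\<in>K. Re (\<phi> z) = C))"
    unfolding v \<omega> \<Gamma>
  proof (intro allI impI ballI, elim conjE)
    fix V \<phi> t K
    assume V: "open V" "V \<subseteq> {z \<in> D 0. generator S z \<noteq> 0}" "is_potential (dual_differential S) V \<phi>"
      and t: "t \<in> T" and K: "connected K" "K \<subseteq> schwarz_curve (S t) (D t) \<inter> V"
    show "\<exists>C. \<forall>z\<in>K. Re (\<phi> z) = C"
    proof (cases "K = {}")
      case False
      then obtain a where "a \<in> K" by blast
      then have "\<forall>z\<in>K. Re (\<phi> z) = Re (\<phi> a)"
        using Re_potential_constant_on_schwarz_curve[OF V t K] by blast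
      then show ?thesis by blast
    qed simp
  qed
  have mero: "\<omega> meromorphic_on D 0" unfolding \<omega> by (rule dual_differential_meromorphic)
  show ?thesis
    by (rule conjI[OF pde conjI[OF a conjI[OF b conjI[OF c conjI[OF mero conjI[OF dual
      conjI[OF tangent conjI[OF _ const_Re]]]]]]]])
      (unfold v \<omega> \<Gamma>, intro ballI impI, rule equipotential_chart)
qed

end
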